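(* The satisfiability problem is decidable for bound-linear schemata: there is an algorithm which, given a bound-linear schema $\phi$, decides whether $\phi$ is satisfiable.
   Context: Schemata. Fix a countably infinite set of arithmetic variables and a countably infinite set $\mathcal P$ of propositional symbols. Linear arithmetic expressions are built from arithmetic variables and $0,s,+,-$, modulo the usual arithmetic laws (so each is an integer linear combination of variables plus an integer constant). An indexed proposition is $p_a$ with $p\in\mathcal P$ and $a$ a linear arithmetic expression (its index); if $a\in\mathbb Z$ it is called a propositional variable. Schemata form the smallest set such that: $\top,\bot$ are schemata; $a<b$ is a schema for linear arithmetic expressions $a,b$ (an arithmetic atom); each indexed proposition is a schema; if $\phi_1,\phi_2$ are schemata so are $\phi_1\vee\phi_2$, $\phi_1\wedge\phi_2$, $\neg\phi_1$; if $\phi$ is a schema not containing $<$, $i$ is an arithmetic variable and $a,b$ are linear arithmetic expressions, then $\bigwedge_{i=a}^b\phi$ and $\bigvee_{i=a}^b\phi$ are schemata (iterations, with bounds $a,b$). A variable $i$ is bound in $\phi$ if $\phi$ contains an iteration over $i$; it is free (a parameter) if it occurs outside the scope of every iteration over $i$. It is assumed that no variable is both free and bound in a schema and that distinct iterations in a schema use distinct variables. Semantics. An interpretation $\mathcal I$ maps every arithmetic variable to an integer and every propositional variable $p_\alpha$ ($\alpha\in\mathbb Z$) to a truth value; for an expression $a$, $[\![a]\!]_{\mathcal I}$ is its integer value. $a<b$ is true iff $[\![a]\!]_{\mathcal I}<[\![b]\!]_{\mathcal I}$; $p_a$ has the value $\mathcal I(p_{[\![a]\!]_{\mathcal I}})$;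 $\top,\bot,\neg,\vee,\wedge$ are as usual; $\bigvee_{i=a}^b\phi$ (resp. $\bigwedge_{i=a}^b\phi$) is true in $\mathcal I$ iff $\phi$ is true in $\mathcal I[\alpha/i]$ (i.e. $\mathcal I$ with $i$ mapped to $\alpha$) for some (resp. every) integer $\alpha$ with $[\![a]\!]_{\mathcal I}\le\alpha\le[\![b]\!]_{\mathcal I}$. Standing assumption: parameters are always interpreted by natural numbers. A schema is satisfiable iff it is true in some such interpretation. A schema $\phi$ is bound-linear iff: (1) $\phi$ contains at most one free arithmetic variable $n$; (2) every non-arithmetic atom in $\phi$ (other than $\top,\bot$) is of the form $p_{\alpha n+\beta i+\gamma}$ where $p\in\mathcal P$, $i$ is a bound variable, $\alpha,\gamma\in\mathbb Z$ and $\beta\in\{-1,0,1\}$; (3) if $\bigvee_{i=a}^b\psi$ or $\bigwedge_{i=a}^b\psi$ is an iteration in $\phi$ then $a,b$ are respectively of the form $\alpha n+\beta$ and $\gamma n+\delta+\epsilon j$ where $\alpha,\beta,\gamma,\delta\in\mathbb Z$, $\epsilon\in\{-1,0,1\}$ and $j$ is a bound variable. *)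

theory Defs
  imports Main "HOL-Library.Nat_Bijection"
begin

section \<open>Schemata\<close>

text \<open>The fixed countably infinite sets of arithmetic variables and of propositional symbols.\<close>

type_synonym avar = nat
type_synonym psym = nat

datatype aexp = AVar avar | Zero | Succ aexp | Plus aexp aexp | Minus aexp aexp

primrec aval :: "(avar \<Rightarrow> int) \<Rightarrow> aexp \<Rightarrow> int" where
  "aval e (AVar v) = e v"
| "aval e Zero = 0"
| "aval e (Succ a) = aval e a + 1"
| "aval e (Plus a b) = aval e a + aval e b"
| "aval e (Minus a b) = aval e a - aval e b"

primrec coeff :: "aexp \<Rightarrow> avar \<Rightarrow> int" where
  "coeff (AVar w) v = (if v = w then 1 else 0)"
| "coeff Zero v = 0"
| "coeff (Succ a) v = coeff a v"
| "coeff (Plus a b) v = coeff a v + coeff b v"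
| "coeff (Minus a b) v = coeff a v - coeff b v"

text \<open>Expressions are taken modulo the arithmetic laws, so a variable occurs in an expression
  only if its coefficient does not cancel: it does not occur in \<open>Minus (AVar v) (AVar v)\<close>.\<close>

definition avars :: "aexp \<Rightarrow> avar set" where
  "avars a = {v. coeff a v \<noteq> 0}"

text \<open>Equality with \<open>\<alpha> n + \<beta> i + \<gamma>\<close> modulo the arithmetic laws, which for linear expressions
  is equality of the values under every assignment.\<close>

definition has_form :: "aexp \<Rightarrow> int \<Rightarrow> avar \<Rightarrow> int \<Rightarrow> avar \<Rightarrow> int \<Rightarrow> bool" where
  "has_form a \<alpha> n \<beta> i \<gamma> \<longleftrightarrow> (\<forall>e. aval e a = \<alpha> * e n + \<beta> * e i + \<gamma>)"

datatype schema =
    Top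
  | Bot
  | Less aexp aexp
  | IProp psym aexp
  | Or schema schema
  | And schema schema
  | Neg schema
  | BigAnd avar aexp aexp schema
  | BigOr avar aexp aexp schema

primrec subschemata :: "schema \<Rightarrow> schema set" where
  "subschemata Top = {Top}"
| "subschemata Bot = {Bot}"
| "subschemata (Less a b) = {Less a b}"
| "subschemata (IProp p a) = {IProp p a}"
| "subschemata (Or f g) = insert (Or f g) (subschemata f \<union> subschemata g)"
| "subschemata (And f g) = insert (And f g) (subschemata f \<union> subschemata g)"
| "subschemata (Neg f) = insert (Neg f) (subschemata f)"
| "subschemata (BigAnd i a b f) = insert (BigAnd i a b f) (subschemata f)"
| "subschemata (BigOr i a b f) = insert (BigOr i a b f) (subschemata f)"

text \<open>The iteration variables, listed once per occurrence of an iteration.\<close>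

primrec iter_vars :: "schema \<Rightarrow> avar list" where
  "iter_vars Top = []"
| "iter_vars Bot = []"
| "iter_vars (Less a b) = []"
| "iter_vars (IProp p a) = []"
| "iter_vars (Or f g) = iter_vars f @ iter_vars g"
| "iter_vars (And f g) = iter_vars f @ iter_vars g"
| "iter_vars (Neg f) = iter_vars f"
| "iter_vars (BigAnd i a b f) = i # iter_vars f"
| "iter_vars (BigOr i a b f) = i # iter_vars f"

definition bound_vars :: "schema \<Rightarrow> avar set" where
  "bound_vars f = set (iter_vars f)"

text \<open>The scope of an iteration is its body; its bounds lie outside of it.\<close>

primrec free_vars :: "schema \<Rightarrow> avar set" where
  "free_vars Top = {}"
| "free_vars Bot = {}"
| "free_vars (Less a b) = avars a \<union> avars b"
| "free_vars (IProp p a) = avars a"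
| "free_vars (Or f g) = free_vars f \<union> free_vars g"
| "free_vars (And f g) = free_vars f \<union> free_vars g"
| "free_vars (Neg f) = free_vars f"
| "free_vars (BigAnd i a b f) = avars a \<union> avars b \<union> (free_vars f - {i})"
| "free_vars (BigOr i a b f) = avars a \<union> avars b \<union> (free_vars f - {i})"

definition is_iteration :: "schema \<Rightarrow> avar \<Rightarrow> aexp \<Rightarrow> aexp \<Rightarrow> schema \<Rightarrow> bool" where
  "is_iteration f i a b g \<longleftrightarrow> f = BigAnd i a b g \<or> f = BigOr i a b g"

definition well_formed :: "schema \<Rightarrow> bool" where
  "well_formed f \<longleftrightarrow>
     (\<forall>i a b g. \<forall>h\<in>subschemata f. is_iteration h i a b g \<longrightarrow> (\<forall>c d. Less c d \<notin> subschemata g)) \<and>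
     free_vars f \<inter> bound_vars f = {} \<and>
     distinct (iter_vars f)"

section \<open>Semantics\<close>

text \<open>An interpretation consists of an assignment \<open>e\<close> of the arithmetic variables and a valuation
  \<open>P\<close>, where \<open>P p k\<close> is the truth value of the propositional variable \<open>p\<^sub>k\<close>.\<close>

primrec truth :: "(psym \<Rightarrow> int \<Rightarrow> bool) \<Rightarrow> schema \<Rightarrow> (avar \<Rightarrow> int) \<Rightarrow> bool" where
  "truth P Top e \<longleftrightarrow> True"
| "truth P Bot e \<longleftrightarrow> False"
| "truth P (Less a b) e \<longleftrightarrow> aval e a < aval e b"
| "truth P (IProp p a) e \<longleftrightarrow> P p (aval e a)"
| "truth P (Or f g) e \<longleftrightarrow> truth P f e \<or> truth P g e"
| "truth P (And f g) e \<longleftrightarrow> truth P f e \<and> truth P g e"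
| "truth P (Neg f) e \<longleftrightarrow> \<not> truth P f e"
| "truth P (BigAnd i a b f) e \<longleftrightarrow> (\<forall>k\<in>{aval e a..aval e b}. truth P f (e(i := k)))"
| "truth P (BigOr i a b f) e \<longleftrightarrow> (\<exists>k\<in>{aval e a..aval e b}. truth P f (e(i := k)))"

definition satisfiable :: "schema \<Rightarrow> bool" where
  "satisfiable f \<longleftrightarrow> (\<exists>e P. (\<forall>v\<in>free_vars f. e v \<ge> 0) \<and> truth P f e)"

section \<open>Bound-linear schemata\<close>

text \<open>The variable \<open>n\<close> is the parameter if there is one and otherwise an arbitrary variable that is
  not bound (it then occurs nowhere, which forces its coefficients to be 0). A bound variable is
  only required to exist where its coefficient is nonzero, so that e.g. \<open>p\<^sub>n\<close> is allowed in a
  schema without iterations.\<close>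

definition bound_linear :: "schema \<Rightarrow> bool" where
  "bound_linear f \<longleftrightarrow> well_formed f \<and>
     (\<exists>n. n \<notin> bound_vars f \<and> free_vars f \<subseteq> {n} \<and>
        (\<forall>p a. IProp p a \<in> subschemata f \<longrightarrow>
           (\<exists>\<alpha> \<beta> \<gamma> i. \<beta> \<in> {-1, 0, 1} \<and> (\<beta> = 0 \<or> i \<in> bound_vars f) \<and> has_form a \<alpha> n \<beta> i \<gamma>)) \<and>
        (\<forall>i a b g. \<forall>h\<in>subschemata f. is_iteration h i a b g \<longrightarrow>
           (\<exists>\<alpha> \<beta>. has_form a \<alpha> n 0 n \<beta>) \<and>
           (\<exists>\<gamma> \<delta> \<epsilon> j. \<epsilon> \<in> {-1, 0, 1} \<and> (\<epsilon> = 0 \<or> j \<in> bound_vars f) \<and> has_form b \<gamma> n \<epsilon> j \<delta>)))"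

section \<open>Decidability\<close>

text \<open>The general recursive functions: the total functions generated from zero, successor and the
  projections by composition, primitive recursion and minimization of regular functions.
  \<open>recursive_fn k f\<close> is meaningful for \<open>f\<close> as a function of \<open>k\<close> arguments, i.e. on lists of
  length \<open>k\<close>; the values of \<open>f\<close> on lists of other lengths are irrelevant.\<close>

inductive recursive_fn :: "nat \<Rightarrow> (nat list \<Rightarrow> nat) \<Rightarrow> bool" where
  zero: "recursive_fn k (\<lambda>xs. 0)"
| succ: "recursive_fn 1 (\<lambda>xs. Suc (hd xs))"
| proj: "i < k \<Longrightarrow> recursive_fn k (\<lambda>xs. xs ! i)"
| comp: "recursive_fn (length gs) f \<Longrightarrow> (\<And>g. g \<in> set gs \<Longrightarrow> recursive_fn k g) \<Longrightarrow>
    recursive_fn k (\<lambda>xs. f (map (\<lambda>g. g xs) gs))"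
| prim_rec: "recursive_fn k f \<Longrightarrow> recursive_fn (Suc (Suc k)) g \<Longrightarrow>
    recursive_fn (Suc k) (\<lambda>xs. rec_nat (f (tl xs)) (\<lambda>m r. g (m # r # tl xs)) (hd xs))"
| minim: "recursive_fn (Suc k) f \<Longrightarrow> (\<And>xs. length xs = k \<Longrightarrow> \<exists>m. f (m # xs) = 0) \<Longrightarrow>
    recursive_fn k (\<lambda>xs. LEAST m. f (m # xs) = 0)"

primrec code_aexp :: "aexp \<Rightarrow> nat" where
  "code_aexp (AVar v) = prod_encode (0, v)"
| "code_aexp Zero = prod_encode (1, 0)"
| "code_aexp (Succ a) = prod_encode (2, code_aexp a)"
| "code_aexp (Plus a b) = prod_encode (3, prod_encode (code_aexp a, code_aexp b))"
| "code_aexp (Minus a b) = prod_encode (4, prod_encode (code_aexp a, code_aexp b))"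

primrec code_schema :: "schema \<Rightarrow> nat" where
  "code_schema Top = prod_encode (0, 0)"
| "code_schema Bot = prod_encode (1, 0)"
| "code_schema (Less a b) = prod_encode (2, prod_encode (code_aexp a, code_aexp b))"
| "code_schema (IProp p a) = prod_encode (3, prod_encode (p, code_aexp a))"
| "code_schema (Or f g) = prod_encode (4, prod_encode (code_schema f, code_schema g))"
| "code_schema (And f g) = prod_encode (5, prod_encode (code_schema f, code_schema g))"
| "code_schema (Neg f) = prod_encode (6, code_schema f)"
| "code_schema (BigAnd i a b f) = prod_encode (7, prod_encode (i,
     prod_encode (code_aexp a, prod_encode (code_aexp b, code_schema f))))"
| "code_schema (BigOr i a b f) = prod_encode (8, prod_encode (i,
     prod_encode (code_aexp a, prod_encode (code_aexp b, code_schema f))))"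

lemma code_aexp_inject: "code_aexp a = code_aexp b \<longleftrightarrow> a = b"
proof (induction a arbitrary: b)
qed (case_tac b; simp add: prod_encode_eq)+

lemma code_schema_inject: "code_schema f = code_schema g \<longleftrightarrow> f = g"
proof (induction f arbitrary: g)
qed (case_tac g; simp add: prod_encode_eq code_aexp_inject)+

text \<open>The property \<open>Q\<close> of schemata is decidable on the class \<open>C\<close>: some recursive function computes
  the truth value of \<open>Q\<close> from the code of any schema in \<open>C\<close>.\<close>

definition decidable_on :: "schema set \<Rightarrow> (schema \<Rightarrow> bool) \<Rightarrow> bool" where
  "decidable_on C Q \<longleftrightarrow>
     (\<exists>d. recursive_fn 1 d \<and> (\<forall>f\<in>C. d [code_schema f] = (if Q f then 1 else 0)))"

end

theory Submission
  imports Defs "HOL-Library.FuncSet"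
begin

text \<open>The truth value of a bound-linear schema depends on each bound variable only through a finite
  \<^emph>\<open>type\<close>: the type of \<open>x\<close> of rank 0 records the propositional variables at \<open>\<alpha> n + \<gamma> \<plusminus> x\<close>, and
  that of rank \<open>m + 1\<close> the sets of types of rank \<open>m\<close> realised on the ranges of iterations whose upper
  bound involves \<open>x\<close>. Such a set, as a function of the upper end of the range, is determined by a local
  recurrence. If \<open>n\<close> is large, then by the pigeonhole principle there are \<open>r < r + d \<le> n / 2\<close> such that
  all labels agree around \<open>q n \<plusminus> r\<close> and \<open>q n \<plusminus> (r + d)\<close>, for all small \<open>q\<close>; deleting the
  intermediate segments replaces \<open>n\<close> by \<open>n - 2 d\<close> and preserves truth. This bounds the parameter by an
  explicit primitive recursive function of the code of the schema, and below the bound only finitely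
  many interpretations matter.\<close>

section \<open>Computable functions\<close>

text \<open>Beside the parameter, an atom or an upper bound contains at most one bound variable,
  with coefficient -1 or 1. Hence single integers, rather than tuples, can be classified: the types
  of the values of the bound variables, each taken separately, decide truth. The obstacle is that an
  iteration runs over an interval whose length is of the order of n, so the set of types on it is
  not local information. But the lower end contains no bound variable. For a fixed lower end the set
  only grows with the upper end, and if it is the same at both ends of a segment, then the segment
  contributes no new type and can be deleted without loss. This is why the labels compared by the
  pigeonhole principle include these accumulated sets and not only the propositional variables. All
  labels are taken in the original interpretation and for all ranks at once, so one deletion serves
  every rank. Several multiples q n have to be watched because indices and bounds contain multiples
  of n, which add up under nesting.\<close>

definition computable :: "nat \<Rightarrow> (nat list \<Rightarrow> nat) \<Rightarrow> bool" where
  "computable k f \<longleftrightarrow> (\<exists>g. recursive_fn k g \<and> (\<forall>xs. length xs = k \<longrightarrow> g xs = f xs))"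

definition decidable :: "nat \<Rightarrow> (nat list \<Rightarrow> bool) \<Rightarrow> bool" where
  "decidable k P \<longleftrightarrow> computable k (\<lambda>xs. if P xs then 1 else 0)"

text \<open>On lists that are long enough this is \<open>xs ! i\<close>; in this form the passage to
  the tail in \<open>arg_tl\<close> needs no condition on the length.\<close>

definition arg :: "nat \<Rightarrow> nat list \<Rightarrow> nat" where
  "arg i xs = hd (drop i xs)"

lemma arg_Cons [simp]: "arg 0 (x # xs) = x" "arg (Suc i) (x # xs) = arg i xs"
  by (simp_all add: arg_def)

lemma arg_tl: "arg i (tl xs) = arg (Suc i) xs"
  by (simp add: arg_def drop_Suc)

lemma computable_cong:
  assumes "computable k f" "\<And>xs. length xs = k \<Longrightarrow> f xs = g xs"
  shows "computable k g"
  using assms unfolding computable_def by metis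

lemma computable_comp:
  assumes "computable (length gs) f" "\<And>g. g \<in> set gs \<Longrightarrow> computable k g"
  shows "computable k (\<lambda>xs. f (map (\<lambda>g. g xs) gs))"
proof -
  obtain f' where f': "recursive_fn (length gs) f'" "\<And>xs. length xs = length gs \<Longrightarrow> f' xs = f xs"
    using assms(1) unfolding computable_def by blast
  have "\<forall>g\<in>set gs. \<exists>g'. recursive_fn k g' \<and> (\<forall>xs. length xs = k \<longrightarrow> g' xs = g xs)"
    using assms(2) unfolding computable_def by blast
  from bchoice[OF this] obtain h where h: "\<And>g. g \<in> set gs \<Longrightarrow> recursive_fn k (h g)"
    "\<And>g xs. g \<in> set gs \<Longrightarrow> length xs = k \<Longrightarrow> h g xs = g xs"
    by blast
  have "recursive_fn k (\<lambda>xs. f' (map (\<lambda>g. g xs) (map h gs)))"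
    by (rule recursive_fn.comp) (use f'(1) h(1) in auto)
  moreover have "f' (map (\<lambda>g. g xs) (map h gs)) = f (map (\<lambda>g. g xs) gs)" if "length xs = k" for xs
  proof -
    have "map (\<lambda>g. g xs) (map h gs) = map (\<lambda>g. g xs) gs"
      using h(2) that by simp
    then show ?thesis by (simp only: f'(2) length_map)
  qed
  ultimately show ?thesis unfolding computable_def by blast
qed

lemma computable_arg:
  assumes "i < k"
  shows "computable k (\<lambda>xs. arg i xs)"
  unfolding computable_def
  using recursive_fn.proj[OF assms] assms by (intro exI[of _ "\<lambda>xs. xs ! i"]) (simp add: arg_def hd_drop_conv_nth)

lemma computable_arg_tl:
  assumes "computable k (\<lambda>xs. arg (Suc i) (g xs))"
  shows "computable k (\<lambda>xs. arg i (tl (g xs)))"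
  using assms by (simp add: arg_tl)

lemma computable_0: "computable k (\<lambda>xs. 0)"
  unfolding computable_def using recursive_fn.zero by blast

lemma computable_comp1:
  assumes "computable 1 (\<lambda>xs. f (arg 0 xs))" "computable k a"
  shows "computable k (\<lambda>xs. f (a xs))"
  using computable_comp[of "[a]" "\<lambda>xs. f (arg 0 xs)" k] assms by simp

lemma computable_comp2:
  assumes "computable 2 (\<lambda>xs. f (arg 0 xs) (arg 1 xs))" "computable k a" "computable k b"
  shows "computable k (\<lambda>xs. f (a xs) (b xs))"
proof -
  have "computable k (\<lambda>xs. (\<lambda>xs. f (arg 0 xs) (arg 1 xs)) (map (\<lambda>g. g xs) [a, b]))"
    by (rule computable_comp) (use assms in \<open>auto simp: eval_nat_numeral\<close>)
  then show ?thesis by (simp add: eval_nat_numeral)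
qed

lemma computable_comp3:
  assumes "computable 3 (\<lambda>xs. f (arg 0 xs) (arg 1 xs) (arg 2 xs))"
    "computable k a" "computable k b" "computable k c"
  shows "computable k (\<lambda>xs. f (a xs) (b xs) (c xs))"
proof -
  have "computable k (\<lambda>xs. (\<lambda>xs. f (arg 0 xs) (arg 1 xs) (arg 2 xs)) (map (\<lambda>g. g xs) [a, b, c]))"
    by (rule computable_comp) (use assms in \<open>auto simp: eval_nat_numeral\<close>)
  then show ?thesis by (simp add: eval_nat_numeral)
qed

lemma computable_comp4:
  assumes "computable 4 (\<lambda>xs. f (arg 0 xs) (arg 1 xs) (arg 2 xs) (arg 3 xs))"
    "computable k a" "computable k b" "computable k c" "computable k d"
  shows "computable k (\<lambda>xs. f (a xs) (b xs) (c xs) (d xs))"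
proof -
  have "computable k (\<lambda>xs. (\<lambda>xs. f (arg 0 xs) (arg 1 xs) (arg 2 xs) (arg 3 xs)) (map (\<lambda>g. g xs) [a, b, c, d]))"
    by (rule computable_comp) (use assms in \<open>auto simp: eval_nat_numeral\<close>)
  then show ?thesis by (simp add: eval_nat_numeral)
qed

lemma computable_Suc:
  assumes "computable k a"
  shows "computable k (\<lambda>xs. Suc (a xs))"
proof (rule computable_comp1[OF _ assms])
  show "computable 1 (\<lambda>xs. Suc (arg 0 xs))"
    unfolding computable_def arg_def using recursive_fn.succ by (intro exI conjI) auto
qed

lemma computable_const: "computable k (\<lambda>xs. n)"
  by (induction n) (auto intro: computable_0 computable_Suc)

lemma length_Suc_Suc_conv: "length ys = Suc (Suc k) \<longleftrightarrow> (\<exists>a b xs. ys = a # b # xs \<and> length xs = k)"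
  by (auto simp: length_Suc_conv)

text \<open>The scheme \<open>prim_rec\<close> expects the recursion argument in front of the
  parameters. Composing with \<open>l # map arg [0..<k]\<close> supplies a computed recursion
  argument and keeps the parameters.\<close>

lemma computable_rec_nat:
  assumes "computable k a" "computable (Suc (Suc k)) (\<lambda>ys. s (arg 0 ys) (arg 1 ys) (tl (tl ys)))"
    "computable k l"
  shows "computable k (\<lambda>xs. rec_nat (a xs) (\<lambda>m r. s m r xs) (l xs))"
proof -
  obtain a' s' where a': "recursive_fn k a'" "\<And>xs. length xs = k \<Longrightarrow> a' xs = a xs"
    and s': "recursive_fn (Suc (Suc k)) s'"
      "\<And>m r xs. length xs = k \<Longrightarrow> s' (m # r # xs) = s m r xs"
    using assms(1,2) unfolding computable_def by (fastforce simp: length_Suc_Suc_conv)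
  define R where "R = (\<lambda>xs. rec_nat (a' (tl xs)) (\<lambda>m r. s' (m # r # tl xs)) (hd xs))"
  have "recursive_fn (Suc k) R"
    unfolding R_def using a'(1) s'(1) by (rule recursive_fn.prim_rec)
  moreover have R: "R (m # xs) = rec_nat (a xs) (\<lambda>m r. s m r xs) m" if "length xs = k" for m xs
    unfolding R_def using a' s' that by (induction m) auto
  ultimately have "computable (Suc k) R"
    unfolding computable_def by blast
  then have "computable (length (l # map arg [0..<k])) R" by simp
  then have "computable k (\<lambda>xs. R (map (\<lambda>g. g xs) (l # map arg [0..<k])))"
    using assms(3) computable_arg by (intro computable_comp) auto
  then show ?thesis
  proof (rule computable_cong)
    fix xs :: "nat list" assume len: "length xs = k"
    have "map (\<lambda>g. g xs) (l # map arg [0..<k]) = l xs # xs"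
      using len by (auto simp: arg_def intro!: nth_equalityI hd_drop_conv_nth)
    then show "R (map (\<lambda>g. g xs) (l # map arg [0..<k])) = rec_nat (a xs) (\<lambda>m r. s m r xs) (l xs)"
      using R len by simp
  qed
qed

section \<open>Arithmetic, case distinction and bounded quantification\<close>

lemma computable_add:
  assumes "computable k a" "computable k b"
  shows "computable k (\<lambda>xs. a xs + b xs)"
proof (rule computable_comp2[OF _ assms])
  have "rec_nat x (\<lambda>_ r. Suc r) y = x + y" for x y :: nat by (induction y) auto
  moreover have "computable 2 (\<lambda>xs. rec_nat (arg 0 xs) (\<lambda>_ r. Suc r) (arg 1 xs))"
    by (intro computable_rec_nat computable_Suc computable_arg) auto
  ultimately show "computable 2 (\<lambda>xs. arg 0 xs + arg 1 xs)" by simp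
qed

lemma computable_mult:
  assumes "computable k a" "computable k b"
  shows "computable k (\<lambda>xs. a xs * b xs)"
proof (rule computable_comp2[OF _ assms])
  have "rec_nat 0 (\<lambda>_ r. r + x) y = x * y" for x y :: nat by (induction y) auto
  moreover have "computable 2 (\<lambda>xs. rec_nat 0 (\<lambda>_ r. r + arg 0 xs) (arg 1 xs))"
    by (intro computable_rec_nat computable_add computable_const computable_arg computable_arg_tl) auto
  ultimately show "computable 2 (\<lambda>xs. arg 0 xs * arg 1 xs)" by simp
qed

lemma computable_power:
  assumes "computable k a" "computable k b"
  shows "computable k (\<lambda>xs. a xs ^ b xs)"
proof (rule computable_comp2[OF _ assms])
  have "rec_nat 1 (\<lambda>_ r. r * x) y = x ^ y" for x y :: nat by (induction y) auto
  moreover have "computable 2 (\<lambda>xs. rec_nat 1 (\<lambda>_ r. r * arg 0 xs) (arg 1 xs))"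
    by (intro computable_rec_nat computable_mult computable_const computable_arg computable_arg_tl) auto
  ultimately show "computable 2 (\<lambda>xs. arg 0 xs ^ arg 1 xs)" by simp
qed

lemma computable_diff:
  assumes "computable k a" "computable k b"
  shows "computable k (\<lambda>xs. a xs - b xs)"
proof (rule computable_comp2[OF _ assms])
  have pred: "rec_nat 0 (\<lambda>m _. m) y = y - 1" for y :: nat by (cases y) auto
  have "rec_nat x (\<lambda>_ r. rec_nat 0 (\<lambda>m _. m) r) y = x - y" for x y :: nat
    unfolding pred by (induction y) auto
  moreover have "computable 2 (\<lambda>xs. rec_nat (arg 0 xs) (\<lambda>_ r. rec_nat 0 (\<lambda>m _. m) r) (arg 1 xs))"
    by (intro computable_rec_nat computable_const computable_arg computable_arg_tl) auto
  ultimately show "computable 2 (\<lambda>xs. arg 0 xs - arg 1 xs)" by simp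
qed

lemma computable_if:
  assumes "decidable k P" "computable k a" "computable k b"
  shows "computable k (\<lambda>xs. if P xs then a xs else b xs)"
proof -
  let ?t = "\<lambda>xs. if P xs then 1 else 0 :: nat"
  have "computable k (\<lambda>xs. ?t xs * a xs + (1 - ?t xs) * b xs)"
    using assms unfolding decidable_def
    by (intro computable_add computable_mult computable_diff computable_const)
  then show ?thesis by (rule computable_cong) simp
qed

lemma decidable_not:
  assumes "decidable k P"
  shows "decidable k (\<lambda>xs. \<not> P xs)"
  unfolding decidable_def using computable_if[OF assms computable_const computable_const, of 0 1]
  by (rule computable_cong) simp

lemma decidable_and:
  assumes "decidable k P" "decidable k Q"
  shows "decidable k (\<lambda>xs. P xs \<and> Q xs)"
  unfolding decidable_def
  using computable_if[OF assms(1) computable_if[OF assms(2) computable_const computable_const] computable_const, of 1 0 0]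
  by (rule computable_cong) simp

lemma decidable_or:
  assumes "decidable k P" "decidable k Q"
  shows "decidable k (\<lambda>xs. P xs \<or> Q xs)"
  unfolding decidable_def
  using computable_if[OF assms(1) computable_const computable_if[OF assms(2) computable_const computable_const], of 1 1 0]
  by (rule computable_cong) simp

lemma decidable_imp:
  assumes "decidable k P" "decidable k Q"
  shows "decidable k (\<lambda>xs. P xs \<longrightarrow> Q xs)"
  using decidable_or[OF decidable_not[OF assms(1)] assms(2)] by (simp only: imp_conv_disj)

lemma decidable_const: "decidable k (\<lambda>xs. b)"
  unfolding decidable_def by (rule computable_const)

lemma decidable_le:
  assumes "computable k a" "computable k b"
  shows "decidable k (\<lambda>xs. a xs \<le> b xs)"
proof -
  have "computable k (\<lambda>xs. 1 - (a xs - b xs))"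
    using assms by (intro computable_diff computable_const)
  then show ?thesis unfolding decidable_def by (rule computable_cong) simp
qed

lemma decidable_less:
  assumes "computable k a" "computable k b"
  shows "decidable k (\<lambda>xs. a xs < b xs)"
  using decidable_le[OF computable_Suc[OF assms(1)] assms(2)] by (simp add: Suc_le_eq)

lemma decidable_eq:
  assumes "computable k a" "computable k b"
  shows "decidable k (\<lambda>xs. a xs = b xs)"
proof -
  have "(\<lambda>xs. a xs = b xs) = (\<lambda>xs. a xs \<le> b xs \<and> b xs \<le> a xs)"
    by (intro ext) linarith
  then show ?thesis
    using decidable_and[OF decidable_le[OF assms] decidable_le[OF assms(2,1)]] by presburger
qed

lemma computable_sum:
  assumes "computable k a" "computable (Suc k) (\<lambda>ys. f (arg 0 ys) (tl ys))"
  shows "computable k (\<lambda>xs. \<Sum>m<a xs. f m xs)"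
proof -
  \<comment> \<open>The recursion step receives counter, accumulator and parameters. The summand
    depends on the first and the last only, so the accumulator is projected away.\<close>
  have "computable (Suc (Suc k)) (\<lambda>ys. (\<lambda>xs. f (arg 0 xs) (tl xs))
      (map (\<lambda>g. g ys) (arg 0 # map (\<lambda>i. arg (Suc (Suc i))) [0..<k])))"
    by (rule computable_comp) (use assms(2) in \<open>auto intro: computable_arg\<close>)
  then have "computable (Suc (Suc k)) (\<lambda>ys. f (arg 0 ys) (tl (tl ys)))"
  proof (rule computable_cong)
    fix ys :: "nat list" assume "length ys = Suc (Suc k)"
    then obtain x y xs where ys: "ys = x # y # xs" "length xs = k" by (auto simp: length_Suc_Suc_conv)
    then have "map (\<lambda>g. g ys) (arg 0 # map (\<lambda>i. arg (Suc (Suc i))) [0..<k]) = x # xs"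
      by (auto simp: arg_def intro!: nth_equalityI hd_drop_conv_nth)
    then show "(\<lambda>xs. f (arg 0 xs) (tl xs))
      (map (\<lambda>g. g ys) (arg 0 # map (\<lambda>i. arg (Suc (Suc i))) [0..<k])) = f (arg 0 ys) (tl (tl ys))"
      using ys by simp
  qed
  then have "computable k (\<lambda>xs. rec_nat 0 (\<lambda>m r. r + f m xs) (a xs))"
    using assms(1) by (intro computable_rec_nat computable_add computable_const computable_arg) auto
  moreover have "rec_nat 0 (\<lambda>m r. r + f m xs) n = (\<Sum>m<n. f m xs)" for n xs
    by (induction n) auto
  ultimately show ?thesis by simp
qed

text \<open>A bounded search succeeds iff the number of witnesses, which is a bounded sum, is
  positive.\<close>

lemma decidable_ex:
  assumes "computable k a" "decidable (Suc k) (\<lambda>ys. P (arg 0 ys) (tl ys))"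
  shows "decidable k (\<lambda>xs. \<exists>m<a xs. P m xs)"
proof -
  have "decidable k (\<lambda>xs. 0 < (\<Sum>m<a xs. if P m xs then 1 else 0 :: nat))"
    using assms by (intro decidable_less computable_sum computable_const computable_if)
  moreover have "0 < (\<Sum>m<n. if P m xs then 1 else 0 :: nat) \<longleftrightarrow> (\<exists>m<n. P m xs)" for n xs
    by (subst neq0_conv[symmetric], subst sum_eq_0_iff) auto
  ultimately show ?thesis by simp
qed

lemma decidable_all:
  assumes "computable k a" "decidable (Suc k) (\<lambda>ys. P (arg 0 ys) (tl ys))"
  shows "decidable k (\<lambda>xs. \<forall>m<a xs. P m xs)"
  using decidable_not[OF decidable_ex[OF assms(1) decidable_not[OF assms(2)]]] by simp

lemmas computable_intros = computable_arg computable_arg_tl computable_const computable_Suc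
  computable_add computable_mult computable_diff computable_power computable_if computable_sum
  decidable_not decidable_and decidable_or decidable_imp decidable_const
  decidable_le decidable_less decidable_eq decidable_ex decidable_all

lemma computable_div:
  assumes "computable k a" "computable k b"
  shows "computable k (\<lambda>xs. a xs div b xs)"
proof (rule computable_comp2[OF _ assms])
  \<comment> \<open>The quotient counts the q with (q + 1) y \<le> x. The value at y = 0 follows the
    convention of \<open>div\<close>.\<close>
  have div_eq: "x div y = (if y = 0 then 0 else \<Sum>q<x. if Suc q * y \<le> x then 1 else 0)" for x y :: nat
  proof (cases "y = 0")
    case False
    have "{q. q < x \<and> Suc q * y \<le> x} = {..<x div y}"
    proof (intro set_eqI, unfold mem_Collect_eq lessThan_iff)
      fix q
      have "Suc q * y \<le> x \<longleftrightarrow> Suc q \<le> x div y"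
        using False by (simp only: less_eq_div_iff_mult_less_eq neq0_conv)
      moreover have "x div y \<le> x" by simp
      ultimately show "q < x \<and> Suc q * y \<le> x \<longleftrightarrow> q < x div y" by linarith
    qed
    then show ?thesis using False
      by (simp add: sum.If_cases Collect_conj_eq[symmetric] lessThan_def)
  qed auto
  have "computable 2 (\<lambda>xs. if arg 1 xs = 0 then 0
      else \<Sum>q<arg 0 xs. if Suc q * arg 1 xs \<le> arg 0 xs then 1 else 0)"
    by (intro computable_intros) auto
  then show "computable 2 (\<lambda>xs. arg 0 xs div arg 1 xs)" by (simp only: div_eq)
qed

lemma computable_mod:
  assumes "computable k a" "computable k b"
  shows "computable k (\<lambda>xs. a xs mod b xs)"
  using computable_diff[OF assms(1) computable_mult[OF computable_div[OF assms] assms(2)]]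
  by (simp only: minus_div_mult_eq_mod)

lemma computable_prod_encode:
  assumes "computable k a" "computable k b"
  shows "computable k (\<lambda>xs. prod_encode (a xs, b xs))"
  unfolding prod_encode_def triangle_def prod.case using assms
  by (intro computable_intros computable_div)

section \<open>Pairing and course-of-values recursion\<close>

abbreviation p1 :: "nat \<Rightarrow> nat" where "p1 x \<equiv> fst (prod_decode x)"
abbreviation p2 :: "nat \<Rightarrow> nat" where "p2 x \<equiv> snd (prod_decode x)"

lemma prod_encode_p1_p2 [simp]: "prod_encode (p1 x, p2 x) = x" by simp

lemma computable_p1:
  assumes "computable k a"
  shows "computable k (\<lambda>xs. p1 (a xs))"
proof (rule computable_comp1[OF _ assms])
  \<comment> \<open>Both components of a pair are at most its code, so the search for them is
    bounded. The sum has at most one nonzero summand and returns the component itself.\<close>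
  have "p1 x = (\<Sum>a<Suc x. if \<exists>b<Suc x. prod_encode (a, b) = x then a else 0)" for x
  proof -
    have "(\<exists>b<Suc x. prod_encode (a, b) = x) \<longleftrightarrow> a = p1 x" for a
      using le_prod_encode_2 by (metis fst_conv le_imp_less_Suc prod_encode_inverse prod_encode_p1_p2)
    moreover have "p1 x < Suc x" using le_prod_encode_1[of "p1 x" "p2 x"] by simp
    ultimately show ?thesis by (simp add: sum.delta del: sum.lessThan_Suc)
  qed
  moreover have "computable 1 (\<lambda>xs. \<Sum>a<Suc (arg 0 xs).
      if \<exists>b<Suc (arg 0 xs). prod_encode (a, b) = arg 0 xs then a else 0)"
    by (intro computable_intros computable_prod_encode) auto
  ultimately show "computable 1 (\<lambda>xs. p1 (arg 0 xs))" by presburger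
qed

lemma computable_p2:
  assumes "computable k a"
  shows "computable k (\<lambda>xs. p2 (a xs))"
proof (rule computable_comp1[OF _ assms])
  have "p2 x = (\<Sum>b<Suc x. if \<exists>a<Suc x. prod_encode (a, b) = x then b else 0)" for x
  proof -
    have "(\<exists>a<Suc x. prod_encode (a, b) = x) \<longleftrightarrow> b = p2 x" for b
      using le_prod_encode_1 by (metis snd_conv le_imp_less_Suc prod_encode_inverse prod_encode_p1_p2)
    moreover have "p2 x < Suc x" using le_prod_encode_2[of "p2 x" "p1 x"] by simp
    ultimately show ?thesis by (simp add: sum.delta del: sum.lessThan_Suc)
  qed
  moreover have "computable 1 (\<lambda>xs. \<Sum>b<Suc (arg 0 xs).
      if \<exists>a<Suc (arg 0 xs). prod_encode (a, b) = arg 0 xs then b else 0)"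
    by (intro computable_intros computable_prod_encode) auto
  ultimately show "computable 1 (\<lambda>xs. p2 (arg 0 xs))" by presburger
qed

text \<open>\<open>hist g m\<close> packs the values at \<open>m - 1, \<dots>, 0\<close>, latest outermost, so that course-of-values recursion
  reduces to primitive recursion.\<close>

definition hist :: "(nat \<Rightarrow> nat \<Rightarrow> nat) \<Rightarrow> nat \<Rightarrow> nat" where
  "hist g m = rec_nat 0 (\<lambda>m h. prod_encode (g m h, h)) m"

text \<open>In a history of length \<open>m\<close>, the entry for \<open>j\<close> lies below
  \<open>m - Suc j\<close> more recent ones.\<close>

definition lookup :: "nat \<Rightarrow> nat \<Rightarrow> nat \<Rightarrow> nat" where
  "lookup m h j = p1 (rec_nat h (\<lambda>_ r. p2 r) (m - Suc j))"

definition cov_rec :: "(nat \<Rightarrow> nat \<Rightarrow> nat) \<Rightarrow> nat \<Rightarrow> nat" where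
  "cov_rec g m = g m (hist g m)"

lemma lookup_hist:
  assumes "j < m"
  shows "lookup m (hist g m) j = cov_rec g j"
proof -
  have "rec_nat (hist g (j + i)) (\<lambda>_ r. p2 r) i = hist g j" for i j
  proof (induction i arbitrary: j)
    case (Suc i)
    from Suc[of "Suc j"] show ?case by (simp add: hist_def)
  qed simp
  from this[of "Suc j" "m - Suc j"] show ?thesis
    using assms by (simp add: lookup_def cov_rec_def) (simp add: hist_def)
qed

lemma computable_lookup:
  assumes "computable k a" "computable k b" "computable k c"
  shows "computable k (\<lambda>xs. lookup (a xs) (b xs) (c xs))"
proof (rule computable_comp3[OF _ assms])
  show "computable 3 (\<lambda>xs. lookup (arg 0 xs) (arg 1 xs) (arg 2 xs))"
    unfolding lookup_def
    by (intro computable_p1 computable_rec_nat computable_p2 computable_intros) auto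
qed

lemma computable_cov_rec:
  assumes "computable (Suc (Suc k)) (\<lambda>ys. g (arg 0 ys) (arg 1 ys) (tl (tl ys)))" "computable k a"
  shows "computable k (\<lambda>xs. cov_rec (\<lambda>m h. g m h xs) (a xs))"
proof -
  have "computable k (\<lambda>xs. p1 (hist (\<lambda>m h. g m h xs) (Suc (a xs))))"
    unfolding hist_def using assms
    by (intro computable_p1 computable_rec_nat computable_prod_encode computable_Suc
        computable_const computable_arg) auto
  then show ?thesis by (simp add: hist_def cov_rec_def)
qed

lemma decidable_mem_set_decode:
  assumes "computable k a" "computable k b"
  shows "decidable k (\<lambda>xs. a xs \<in> set_decode (b xs))"
proof -
  have "x \<in> set_decode y \<longleftrightarrow> (y div 2 ^ x) mod 2 = 1" for x y
    by (simp add: set_decode_def odd_iff_mod_2_eq_one)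
  moreover have "decidable k (\<lambda>xs. (b xs div 2 ^ a xs) mod 2 = 1)"
    using assms by (intro computable_intros computable_div computable_mod)
  ultimately show ?thesis by presburger
qed

section \<open>Bound-linear schemata with bounded coefficients\<close>

text \<open>The size estimates for codes rest on this inequality: a nonzero tag adds at least 2, so
  a code strictly exceeds the codes of its parts.\<close>

lemma prod_encode_ge: "2 * a + b \<le> prod_encode (a, b)"
proof -
  have "k \<le> triangle k" for k by (induction k) auto
  from this[of "a + b"] show ?thesis by (simp add: prod_encode_def)
qed

lemma coeff_eq: "coeff a v = aval (\<lambda>u. if u = v then 1 else 0) a - aval (\<lambda>_. 0) a"
  by (induction a) auto

text \<open>The summand 1 is forced by the variable 0, whose code is 0 and whose coefficient is
  1.\<close>

lemma abs_coeff_le: "\<bar>coeff a v\<bar> \<le> int (code_aexp a) + 1"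
proof (induction a)
  case (Succ a)
  then show ?case using prod_encode_ge[of 2 "code_aexp a"] by simp
next
  case (Plus a b)
  then show ?case
    using prod_encode_ge[of 3 "prod_encode (code_aexp a, code_aexp b)"] prod_encode_ge[of "code_aexp a" "code_aexp b"]
    by simp
next
  case (Minus a b)
  then show ?case
    using prod_encode_ge[of 4 "prod_encode (code_aexp a, code_aexp b)"] prod_encode_ge[of "code_aexp a" "code_aexp b"]
    by simp
qed auto

lemma abs_const_le: "\<bar>aval (\<lambda>_. 0) a\<bar> \<le> int (code_aexp a) + 1"
proof (induction a)
  case (Succ a)
  then show ?case using prod_encode_ge[of 2 "code_aexp a"] by simp
next
  case (Plus a b)
  then show ?case
    using prod_encode_ge[of 3 "prod_encode (code_aexp a, code_aexp b)"] prod_encode_ge[of "code_aexp a" "code_aexp b"]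
    by simp
next
  case (Minus a b)
  then show ?case
    using prod_encode_ge[of 4 "prod_encode (code_aexp a, code_aexp b)"] prod_encode_ge[of "code_aexp a" "code_aexp b"]
    by simp
qed auto

text \<open>The number of a variable is at most the code of any expression containing it, so the sum
  up to \<open>V\<close> misses no variable.\<close>

lemma aval_eq_sum:
  "code_aexp a \<le> V \<Longrightarrow> aval e a = aval (\<lambda>_. 0) a + (\<Sum>v\<le>V. coeff a v * e v)"
proof (induction a)
  case (AVar u)
  then have "u \<le> V" using prod_encode_ge[of 0 u] by simp
  moreover have "(\<Sum>v\<le>V. coeff (AVar u) v * e v) = (\<Sum>v\<le>V. if v = u then e v else 0)"
    by (intro sum.cong) auto
  ultimately show ?case by (simp add: sum.delta)
next
  case (Succ a)
  then show ?case using prod_encode_ge[of 2 "code_aexp a"] by simp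
next
  case (Plus a b)
  then show ?case
    using prod_encode_ge[of 3 "prod_encode (code_aexp a, code_aexp b)"] prod_encode_ge[of "code_aexp a" "code_aexp b"]
    by (simp add: distrib_right sum.distrib)
next
  case (Minus a b)
  then show ?case
    using prod_encode_ge[of 4 "prod_encode (code_aexp a, code_aexp b)"] prod_encode_ge[of "code_aexp a" "code_aexp b"]
    by (simp add: left_diff_distrib sum_subtractf)
qed auto

lemma aval_cong:
  assumes "\<And>v. v \<in> avars a \<Longrightarrow> e v = e' v"
  shows "aval e a = aval e' a"
proof -
  have "(\<Sum>v\<le>code_aexp a. coeff a v * e v) = (\<Sum>v\<le>code_aexp a. coeff a v * e' v)"
    using assms by (intro sum.cong) (auto simp: avars_def)
  then show ?thesis
    using aval_eq_sum[of a "code_aexp a" e] aval_eq_sum[of a "code_aexp a" e'] by simp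
qed

lemma truth_cong:
  "(\<And>v. v \<in> free_vars f \<Longrightarrow> e v = e' v) \<Longrightarrow> truth P f e = truth P f e'"
proof (induction f arbitrary: e e')
  case (Less a b)
  then show ?case using aval_cong[of a e e'] aval_cong[of b e e'] by simp
next
  case (IProp p a)
  then show ?case using aval_cong[of a e e'] by simp
next
  case (BigAnd i a b f)
  have "truth P f (e(i := k)) = truth P f (e'(i := k))" for k
    using BigAnd.prems by (intro BigAnd.IH) auto
  then show ?case using aval_cong[of a e e'] aval_cong[of b e e'] BigAnd.prems by simp
next
  case (BigOr i a b f)
  have "truth P f (e(i := k)) = truth P f (e'(i := k))" for k
    using BigOr.prems by (intro BigOr.IH) auto
  then show ?case using aval_cong[of a e e'] aval_cong[of b e e'] BigOr.prems by simp
next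
  case (Or f g)
  have "truth P f e = truth P f e'" by (rule Or.IH(1)) (use Or.prems in auto)
  moreover have "truth P g e = truth P g e'" by (rule Or.IH(2)) (use Or.prems in auto)
  ultimately show ?case by simp
next
  case (And f g)
  have "truth P f e = truth P f e'" by (rule And.IH(1)) (use And.prems in auto)
  moreover have "truth P g e = truth P g e'" by (rule And.IH(2)) (use And.prems in auto)
  ultimately show ?case by simp
next
  case (Neg f)
  have "truth P f e = truth P f e'" by (rule Neg.IH) (use Neg.prems in auto)
  then show ?case by simp
qed auto

section \<open>Normal forms with all constants bounded by \<open>c\<close>\<close>

definition param_term :: "nat \<Rightarrow> avar \<Rightarrow> aexp \<Rightarrow> bool" where
  "param_term c v a \<longleftrightarrow>
     (\<exists>\<alpha> \<gamma>. \<bar>\<alpha>\<bar> \<le> int c \<and> \<bar>\<gamma>\<bar> \<le> int c \<and> (\<forall>e. aval e a = \<alpha> * e v + \<gamma>))"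

text \<open>The variable \<open>j\<close> has to occur in \<open>a\<close> itself, not merely to be
  bound somewhere: the later hypotheses on assignments concern only the free variables of the
  subschema at hand.\<close>

definition index_term :: "nat \<Rightarrow> avar \<Rightarrow> aexp \<Rightarrow> bool" where
  "index_term c v a \<longleftrightarrow>
     (\<exists>\<alpha> \<gamma> \<epsilon> j. \<bar>\<alpha>\<bar> \<le> int c \<and> \<bar>\<gamma>\<bar> \<le> int c \<and> \<epsilon> \<in> {-1, 0, 1} \<and>
        (\<epsilon> = 0 \<or> j \<in> avars a - {v}) \<and> (\<forall>e. aval e a = \<alpha> * e v + \<gamma> + \<epsilon> * e j))"

text \<open>In an arithmetic atom only the constant is bounded: once n exceeds \<open>c\<close>, the
  coefficient of n matters only through its sign. The condition \<open>i \<noteq> v\<close> ensures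
  that running through an iteration leaves the value of the parameter alone.\<close>

primrec uniform :: "nat \<Rightarrow> avar \<Rightarrow> schema \<Rightarrow> bool" where
  "uniform c v Top \<longleftrightarrow> True"
| "uniform c v Bot \<longleftrightarrow> True"
| "uniform c v (Less a b) \<longleftrightarrow> (\<exists>\<alpha> \<gamma>. \<bar>\<gamma>\<bar> \<le> int c \<and> (\<forall>e. aval e b - aval e a = \<alpha> * e v + \<gamma>))"
| "uniform c v (IProp p a) \<longleftrightarrow> p \<le> c \<and> index_term c v a"
| "uniform c v (Or f g) \<longleftrightarrow> uniform c v f \<and> uniform c v g"
| "uniform c v (And f g) \<longleftrightarrow> uniform c v f \<and> uniform c v g"
| "uniform c v (Neg f) \<longleftrightarrow> uniform c v f"
| "uniform c v (BigAnd i a b f) \<longleftrightarrow> i \<noteq> v \<and> param_term c v a \<and> index_term c v b \<and> uniform c v f"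
| "uniform c v (BigOr i a b f) \<longleftrightarrow> i \<noteq> v \<and> param_term c v a \<and> index_term c v b \<and> uniform c v f"

primrec depth :: "schema \<Rightarrow> nat" where
  "depth Top = 0"
| "depth Bot = 0"
| "depth (Less a b) = 0"
| "depth (IProp p a) = 0"
| "depth (Or f g) = max (depth f) (depth g)"
| "depth (And f g) = max (depth f) (depth g)"
| "depth (Neg f) = depth f"
| "depth (BigAnd i a b f) = Suc (depth f)"
| "depth (BigOr i a b f) = Suc (depth f)"

text \<open>The zero assignment and the unit assignments recover the coefficients. For
  \<open>i = n\<close> with a nonzero \<beta> only the sum of \<alpha> and \<beta> would be
  determined.\<close>

lemma has_form_coeff:
  assumes "has_form a \<alpha> n \<beta> i \<gamma>" "\<beta> = 0 \<or> i \<noteq> n"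
  shows "\<gamma> = aval (\<lambda>_. 0) a" "\<alpha> = coeff a n" "\<beta> = 0 \<or> \<beta> = coeff a i"
proof -
  have *: "aval e a = \<alpha> * e n + \<beta> * e i + \<gamma>" for e using assms(1) by (simp add: has_form_def)
  show "\<gamma> = aval (\<lambda>_. 0) a" using *[of "\<lambda>_. 0"] by simp
  then show "\<alpha> = coeff a n" "\<beta> = 0 \<or> \<beta> = coeff a i"
    using *[of "\<lambda>u. if u = n then 1 else 0"] *[of "\<lambda>u. if u = i then 1 else 0"] assms(2)
    by (auto simp: coeff_eq)
qed

lemma index_termI:
  assumes "has_form a \<alpha> n \<beta> i \<gamma>" "\<beta> = 0 \<or> i \<noteq> n" "\<beta> \<in> {-1, 0, 1}" "code_aexp a < c"
  shows "index_term c n a"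
proof -
  note co = has_form_coeff[OF assms(1,2)]
  have "\<bar>\<alpha>\<bar> \<le> int c" "\<bar>\<gamma>\<bar> \<le> int c"
    unfolding co(1,2) using abs_coeff_le[of a n] abs_const_le[of a] assms(4) by linarith+
  moreover have "\<beta> = 0 \<or> i \<in> avars a - {n}"
    using co(3) assms(2) by (auto simp: avars_def)
  moreover have "\<forall>e. aval e a = \<alpha> * e n + \<gamma> + \<beta> * e i"
    using assms(1) by (auto simp: has_form_def)
  ultimately show ?thesis unfolding index_term_def using assms(3) by blast
qed

lemma param_termI:
  assumes "has_form a \<alpha> n 0 i \<gamma>" "code_aexp a < c"
  shows "param_term c n a"
proof -
  have "\<bar>\<alpha>\<bar> \<le> int c" "\<bar>\<gamma>\<bar> \<le> int c"
    using has_form_coeff(1,2)[OF assms(1)] abs_coeff_le[of a n] abs_const_le[of a] assms(2) by auto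
  then show ?thesis
    using assms(1) unfolding param_term_def has_form_def by auto
qed

lemma code_less_iter:
  assumes "0 < k"
  shows "x < prod_encode (k, prod_encode (i, prod_encode (x, prod_encode (y, z))))"
    and "y < prod_encode (k, prod_encode (i, prod_encode (x, prod_encode (y, z))))"
    and "i < prod_encode (k, prod_encode (i, prod_encode (x, prod_encode (y, z))))"
    and "z < prod_encode (k, prod_encode (i, prod_encode (x, prod_encode (y, z))))"
  using assms prod_encode_ge[of k "prod_encode (i, prod_encode (x, prod_encode (y, z)))"]
    prod_encode_ge[of i "prod_encode (x, prod_encode (y, z))"]
    prod_encode_ge[of x "prod_encode (y, z)"] prod_encode_ge[of y z]
  by linarith+

lemma code_less_binary:
  assumes "0 < k"
  shows "x < prod_encode (k, prod_encode (x, y))" "y < prod_encode (k, prod_encode (x, y))"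
  using assms prod_encode_ge[of k "prod_encode (x, y)"] prod_encode_ge[of x y] by linarith+

lemma code_less_unary: "0 < k \<Longrightarrow> x < prod_encode (k, x)"
  using prod_encode_ge[of k x] by linarith

text \<open>Bound linearity refers to the bound variables of the whole schema and not to those of a
  subschema. \<open>Q\<close> and \<open>B\<close> stand for the subschemata and the bound variables
  of the whole, and stay fixed during the induction.\<close>

lemma uniformI:
  assumes "\<And>p a. Q (IProp p a) \<Longrightarrow>
      \<exists>\<alpha> \<beta> \<gamma> i. \<beta> \<in> {-1, 0, 1} \<and> (\<beta> = 0 \<or> i \<in> B) \<and> has_form a \<alpha> n \<beta> i \<gamma>"
    and "\<And>i a b g h. Q h \<Longrightarrow> is_iteration h i a b g \<Longrightarrow> i \<in> B \<and>
      (\<exists>\<alpha> \<beta>. has_form a \<alpha> n 0 n \<beta>) \<and>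
      (\<exists>\<gamma> \<delta> \<epsilon> j. \<epsilon> \<in> {-1, 0, 1} \<and> (\<epsilon> = 0 \<or> j \<in> B) \<and> has_form b \<gamma> n \<epsilon> j \<delta>)"
    and "\<And>a b. Q (Less a b) \<Longrightarrow> avars a \<union> avars b \<subseteq> {n}"
    and "n \<notin> B" "\<forall>h\<in>subschemata f. Q h" "code_schema f < c"
  shows "uniform c n f"
  using assms(5,6)
proof (induction f)
  case (Less a b)
  have lin: "aval e a = coeff a n * e n + aval (\<lambda>_. 0) a" if "avars a \<subseteq> {n}" for a e
  proof -
    have "(\<Sum>v\<le>code_aexp a + n. coeff a v * e v) = (\<Sum>v\<le>code_aexp a + n. if v = n then coeff a v * e v else 0)"
      using that by (intro sum.cong) (auto simp: avars_def)
    also have "\<dots> = coeff a n * e n" by (simp add: sum.delta)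
    finally show ?thesis using aval_eq_sum[of a "code_aexp a + n" e] by simp
  qed
  have "avars a \<subseteq> {n}" "avars b \<subseteq> {n}" using assms(3)[of a b] Less.prems(1) by auto
  then have "aval e b - aval e a = (coeff b n - coeff a n) * e n + (aval (\<lambda>_. 0) b - aval (\<lambda>_. 0) a)" for e
    using lin[of a e] lin[of b e] by (simp add: left_diff_distrib)
  moreover have "\<bar>aval (\<lambda>_. 0) b - aval (\<lambda>_. 0) a\<bar> \<le> int c"
    using abs_const_le[of a] abs_const_le[of b] Less.prems(2)
      prod_encode_ge[of 2 "prod_encode (code_aexp a, code_aexp b)"] prod_encode_ge[of "code_aexp a" "code_aexp b"]
    by simp
  ultimately show ?case unfolding uniform.simps by (intro exI conjI allI)
next
  case (IProp p a)
  have "Q (IProp p a)" using IProp.prems(1) by simp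
  from assms(1)[OF this] obtain \<alpha> \<beta> \<gamma> i where
    f: "has_form a \<alpha> n \<beta> i \<gamma>" "\<beta> = 0 \<or> i \<in> B" "\<beta> \<in> {-1, 0, 1}" by (elim exE conjE)
  have "\<beta> = 0 \<or> i \<noteq> n" using f(2) assms(4) by blast
  note f = f(1) this f(3)
  have lt: "code_aexp a < c" "p < c"
    using IProp.prems(2) code_less_binary[of 3, where x = p and y = "code_aexp a"] by auto
  show ?case using index_termI[OF f lt(1)] lt(2) by simp
next
  case (BigAnd i a b f)
  have lt: "code_aexp a < c" "code_aexp b < c" "code_schema f < c"
    using BigAnd.prems(2) code_less_iter[of 7, where x = "code_aexp a" and y = "code_aexp b" and i = i and z = "code_schema f"]
    by auto
  have iter: "is_iteration (BigAnd i a b f) i a b f" "Q (BigAnd i a b f)"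
    using BigAnd.prems(1) by (simp_all add: is_iteration_def)
  note * = assms(2)[OF iter(2,1)]
  from * obtain \<alpha> \<beta> \<gamma> \<delta> \<epsilon> j where f: "has_form a \<alpha> n 0 n \<beta>"
    "has_form b \<gamma> n \<epsilon> j \<delta>" "\<epsilon> = 0 \<or> j \<in> B" "\<epsilon> \<in> {-1, 0, 1}" by (elim exE conjE)
  have "\<epsilon> = 0 \<or> j \<noteq> n" "i \<noteq> n" using f(3) conjunct1[OF *] assms(4) by blast+
  moreover have "uniform c n f" using BigAnd lt(3) by simp
  ultimately show ?case
    using param_termI[OF f(1) lt(1)] index_termI[OF f(2) _ f(4) lt(2)] by simp
next
  case (BigOr i a b f)
  have lt: "code_aexp a < c" "code_aexp b < c" "code_schema f < c"
    using BigOr.prems(2) code_less_iter[of 8, where x = "code_aexp a" and y = "code_aexp b" and i = i and z = "code_schema f"]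
    by auto
  have iter: "is_iteration (BigOr i a b f) i a b f" "Q (BigOr i a b f)"
    using BigOr.prems(1) by (simp_all add: is_iteration_def)
  note * = assms(2)[OF iter(2,1)]
  from * obtain \<alpha> \<beta> \<gamma> \<delta> \<epsilon> j where f: "has_form a \<alpha> n 0 n \<beta>"
    "has_form b \<gamma> n \<epsilon> j \<delta>" "\<epsilon> = 0 \<or> j \<in> B" "\<epsilon> \<in> {-1, 0, 1}" by (elim exE conjE)
  have "\<epsilon> = 0 \<or> j \<noteq> n" "i \<noteq> n" using f(3) conjunct1[OF *] assms(4) by blast+
  moreover have "uniform c n f" using BigOr lt(3) by simp
  ultimately show ?case
    using param_termI[OF f(1) lt(1)] index_termI[OF f(2) _ f(4) lt(2)] by simp
next
  case (Or f g)
  have "code_schema f < c" "code_schema g < c"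
    using Or.prems(2) code_less_binary[of 4, where x = "code_schema f" and y = "code_schema g"] by auto
  then show ?case using Or by simp
next
  case (And f g)
  have "code_schema f < c" "code_schema g < c"
    using And.prems(2) code_less_binary[of 5, where x = "code_schema f" and y = "code_schema g"] by auto
  then show ?case using And by simp
next
  case (Neg f)
  have "code_schema f < c" using Neg.prems(2) code_less_unary[of 6 "code_schema f"] by auto
  then show ?case using Neg by simp
qed auto

lemma depth_le_code: "depth f \<le> code_schema f"
proof (induction f)
  case (Or f g)
  then show ?case
    using code_less_binary[of 4, where x = "code_schema f" and y = "code_schema g"] by simp
next
  case (And f g)
  then show ?case
    using code_less_binary[of 5, where x = "code_schema f" and y = "code_schema g"] by simp
next
  case (Neg f)
  then show ?case using code_less_unary[of 6 "code_schema f"] by simp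
next
  case (BigAnd i a b f)
  then show ?case using code_less_iter(4)[of 7, where z = "code_schema f" and i = i and x = "code_aexp a" and y = "code_aexp b"] by simp
next
  case (BigOr i a b f)
  then show ?case using code_less_iter(4)[of 8, where z = "code_schema f" and i = i and x = "code_aexp a" and y = "code_aexp b"] by simp
qed auto

text \<open>An arithmetic atom lies outside every iteration, so none of its variables is captured on
  the way up.\<close>

lemma avars_Less_subset:
  assumes "\<And>i x y g. Q (BigAnd i x y g) \<Longrightarrow> Less a b \<notin> subschemata g"
    and "\<And>i x y g. Q (BigOr i x y g) \<Longrightarrow> Less a b \<notin> subschemata g"
    and "\<forall>h\<in>subschemata f. Q h" "Less a b \<in> subschemata f"
  shows "avars a \<union> avars b \<subseteq> free_vars f"
  using assms(3,4)
proof (induction f)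
  case (BigAnd i x y g)
  then show ?case using assms(1)[of i x y g] by simp
next
  case (BigOr i x y g)
  then show ?case using assms(2)[of i x y g] by simp
qed auto

lemma iteration_in_bound_vars:
  "h \<in> subschemata f \<Longrightarrow> is_iteration h i a b g \<Longrightarrow> i \<in> bound_vars f"
  by (induction f) (auto simp: is_iteration_def bound_vars_def)

text \<open>One number computed from the input bounds everything at once: the code strictly
  dominates the codes of all parts, hence also the coefficients, the constants and the propositional
  symbols.\<close>

lemma bound_linear_uniform:
  assumes "bound_linear f"
  obtains n where "free_vars f \<subseteq> {n}" "uniform (Suc (code_schema f)) n f"
proof -
  from assms have wf: "well_formed f" and ex: "\<exists>n. n \<notin> bound_vars f \<and> free_vars f \<subseteq> {n} \<and>
        (\<forall>p a. IProp p a \<in> subschemata f \<longrightarrow>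
           (\<exists>\<alpha> \<beta> \<gamma> i. \<beta> \<in> {-1, 0, 1} \<and> (\<beta> = 0 \<or> i \<in> bound_vars f) \<and> has_form a \<alpha> n \<beta> i \<gamma>)) \<and>
        (\<forall>i a b g. \<forall>h\<in>subschemata f. is_iteration h i a b g \<longrightarrow>
           (\<exists>\<alpha> \<beta>. has_form a \<alpha> n 0 n \<beta>) \<and>
           (\<exists>\<gamma> \<delta> \<epsilon> j. \<epsilon> \<in> {-1, 0, 1} \<and> (\<epsilon> = 0 \<or> j \<in> bound_vars f) \<and> has_form b \<gamma> n \<epsilon> j \<delta>))"
    unfolding bound_linear_def by (rule conjunct1, rule conjunct2)
  from ex obtain n where n: "n \<notin> bound_vars f" "free_vars f \<subseteq> {n}"
    and at: "\<forall>p a. IProp p a \<in> subschemata f \<longrightarrow>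
           (\<exists>\<alpha> \<beta> \<gamma> i. \<beta> \<in> {-1, 0, 1} \<and> (\<beta> = 0 \<or> i \<in> bound_vars f) \<and> has_form a \<alpha> n \<beta> i \<gamma>)"
    and it: "\<forall>i a b g. \<forall>h\<in>subschemata f. is_iteration h i a b g \<longrightarrow>
           (\<exists>\<alpha> \<beta>. has_form a \<alpha> n 0 n \<beta>) \<and>
           (\<exists>\<gamma> \<delta> \<epsilon> j. \<epsilon> \<in> {-1, 0, 1} \<and> (\<epsilon> = 0 \<or> j \<in> bound_vars f) \<and> has_form b \<gamma> n \<epsilon> j \<delta>)"
    by (elim exE conjE)
  have "\<forall>h\<in>subschemata f. \<forall>i a b g. is_iteration h i a b g \<longrightarrow> (\<forall>c d. Less c d \<notin> subschemata g)"
    using conjunct1[OF wf[unfolded well_formed_def]] by fast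
  then have "avars a \<union> avars b \<subseteq> free_vars f" if "Less a b \<in> subschemata f" for a b
    using avars_Less_subset[OF _ _ _ that, where Q = "\<lambda>h. \<forall>i a b g. is_iteration h i a b g \<longrightarrow> (\<forall>c d. Less c d \<notin> subschemata g)"]
    unfolding is_iteration_def by blast
  then have le: "avars a \<union> avars b \<subseteq> {n}" if "Less a b \<in> subschemata f" for a b
    using n(2) that by blast
  have "uniform (Suc (code_schema f)) n f"
  proof (rule uniformI[where Q = "\<lambda>h. h \<in> subschemata f" and B = "bound_vars f"])
    show "\<exists>\<alpha> \<beta> \<gamma> i. \<beta> \<in> {-1, 0, 1} \<and> (\<beta> = 0 \<or> i \<in> bound_vars f) \<and> has_form a \<alpha> n \<beta> i \<gamma>"
      if "IProp p a \<in> subschemata f" for p a using at that by (elim allE impE)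
    show "i \<in> bound_vars f \<and> (\<exists>\<alpha> \<beta>. has_form a \<alpha> n 0 n \<beta>) \<and>
      (\<exists>\<gamma> \<delta> \<epsilon> j. \<epsilon> \<in> {-1, 0, 1} \<and> (\<epsilon> = 0 \<or> j \<in> bound_vars f) \<and> has_form b \<gamma> n \<epsilon> j \<delta>)"
      if "h \<in> subschemata f" "is_iteration h i a b g" for i a b g h
      by (rule conjI[OF iteration_in_bound_vars[OF that]
            it[THEN spec, THEN spec, THEN spec, THEN spec, THEN bspec, THEN mp, OF that]])
    show "avars a \<union> avars b \<subseteq> {n}" if "Less a b \<in> subschemata f" for a b
      using le[OF that] .
  qed (use n in simp_all)
  then show ?thesis using that n(2) by blast
qed

section \<open>Types of integers\<close>

text \<open>Numbering the types lets \<open>type_of\<close> return natural numbers at every rank, so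
  that the ranks can be generated by one recursion. The choice of the numbering is immaterial; only
  the number of types enters the algorithm.\<close>

definition encode :: "'a set \<Rightarrow> 'a \<Rightarrow> nat" where
  "encode F = (SOME h. bij_betw h F {..<card F})"

lemma encode_bij: "finite F \<Longrightarrow> bij_betw (encode F) F {..<card F}"
  unfolding encode_def using ex_bij_betw_finite_nat[of F]
  by (intro someI_ex[of "\<lambda>h. bij_betw h F {..<card F}"]) (simp add: atLeast0LessThan)

lemma encode_less: "finite F \<Longrightarrow> x \<in> F \<Longrightarrow> encode F x < card F"
  using encode_bij[of F] by (auto simp: bij_betw_def)

lemma encode_eqD: "finite F \<Longrightarrow> x \<in> F \<Longrightarrow> y \<in> F \<Longrightarrow> encode F x = encode F y \<Longrightarrow> x = y"
  using encode_bij[of F] by (auto simp: bij_betw_def inj_on_def)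

definition coeffs :: "nat \<Rightarrow> int set" where
  "coeffs c = {- int c..int c}"

definition signs :: "int set" where
  "signs = {-1, 0, 1}"

lemma finite_coeffs [simp]: "finite (coeffs c)" and card_coeffs: "card (coeffs c) = 2 * c + 1"
  by (auto simp: coeffs_def)

lemma finite_signs [simp]: "finite signs" and card_signs: "card signs = 3"
  by (auto simp: signs_def)

lemma mem_coeffs: "k \<in> coeffs c \<longleftrightarrow> \<bar>k\<bar> \<le> int c"
  by (auto simp: coeffs_def)

definition atoms :: "nat \<Rightarrow> (nat \<times> int \<times> int \<times> int) set" where
  "atoms c = {..c} \<times> coeffs c \<times> coeffs c \<times> signs"

definition bounds :: "nat \<Rightarrow> (int \<times> int \<times> int \<times> int \<times> int) set" where
  "bounds c = coeffs c \<times> coeffs c \<times> coeffs c \<times> coeffs c \<times> signs"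

definition atom_types :: "nat \<Rightarrow> (nat \<times> int \<times> int \<times> int \<Rightarrow> bool) set" where
  "atom_types c = PiE (atoms c) (\<lambda>_. UNIV)"

definition iter_types :: "nat \<Rightarrow> nat \<Rightarrow> (nat \<times> (int \<times> int \<times> int \<times> int \<times> int \<Rightarrow> nat set)) set" where
  "iter_types c M = {..<M} \<times> PiE (bounds c) (\<lambda>_. Pow {..<M})"

text \<open>The cardinalities of \<open>atom_types\<close> and \<open>iter_types\<close>: the
  factors of the exponents count the propositional symbols (\<open>c + 1\<close>), the coefficients
  (\<open>2 * c + 1\<close>) and the signs (3). Their growth is irrelevant, but they must be
  computable from \<open>c\<close>.\<close>

primrec num_types :: "nat \<Rightarrow> nat \<Rightarrow> nat" where
  "num_types c 0 = 2 ^ ((c + 1) * ((2 * c + 1) * ((2 * c + 1) * 3)))"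
| "num_types c (Suc m) = num_types c m *
     (2 ^ num_types c m) ^ ((2 * c + 1) * ((2 * c + 1) * ((2 * c + 1) * ((2 * c + 1) * 3))))"

lemma finite_atom_types: "finite (atom_types c)" and card_atom_types: "card (atom_types c) = num_types c 0"
  unfolding atom_types_def atoms_def
  by (auto intro!: finite_PiE simp: card_PiE card_cartesian_product card_coeffs card_signs)

lemma finite_iter_types: "finite (iter_types c M)" and card_iter_types:
  "card (iter_types c M) = M * (2 ^ M) ^ ((2 * c + 1) * ((2 * c + 1) * ((2 * c + 1) * ((2 * c + 1) * 3))))"
  unfolding iter_types_def bounds_def
  by (auto intro!: finite_PiE simp: card_PiE card_cartesian_product card_coeffs card_signs card_Pow)

text \<open>Keeping \<open>type_of c n P m x\<close> as a component makes each rank refine the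
  previous one. The restrictions to \<open>atoms c\<close> and \<open>bounds c\<close> make the
  number of types finite, independently of \<open>n\<close> and \<open>P\<close>.\<close>

primrec type_of :: "nat \<Rightarrow> int \<Rightarrow> (psym \<Rightarrow> int \<Rightarrow> bool) \<Rightarrow> nat \<Rightarrow> int \<Rightarrow> nat" where
  "type_of c n P 0 = (\<lambda>x. encode (atom_types c)
     (restrict (\<lambda>(p, \<alpha>, \<gamma>, \<epsilon>). P p (\<alpha> * n + \<gamma> + \<epsilon> * x)) (atoms c)))"
| "type_of c n P (Suc m) = (\<lambda>x. encode (iter_types c (num_types c m))
     (type_of c n P m x,
      restrict (\<lambda>(\<alpha>, \<beta>, \<gamma>, \<delta>, \<epsilon>). type_of c n P m ` {\<alpha> * n + \<beta>..\<gamma> * n + \<delta> + \<epsilon> * x}) (bounds c)))"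

lemma type_of_less: "type_of c n P m x < num_types c m"
proof (induction m arbitrary: x)
  case 0
  have "type_of c n P 0 x < card (atom_types c)"
    unfolding type_of.simps by (rule encode_less[OF finite_atom_types]) (auto simp: atom_types_def)
  then show ?case by (simp only: card_atom_types)
next
  case (Suc m)
  have "type_of c n P (Suc m) x < card (iter_types c (num_types c m))"
    unfolding type_of.simps
    by (rule encode_less[OF finite_iter_types]) (use Suc in \<open>auto simp: iter_types_def\<close>)
  then show ?case by (simp only: card_iter_types num_types.simps)
qed

lemma type_of_0_eqD:
  assumes "type_of c n P 0 x = type_of c n' P' 0 x'" "p \<le> c" "\<alpha> \<in> coeffs c" "\<gamma> \<in> coeffs c" "\<epsilon> \<in> signs"
  shows "P p (\<alpha> * n + \<gamma> + \<epsilon> * x) = P' p (\<alpha> * n' + \<gamma> + \<epsilon> * x')"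
proof -
  have "restrict (\<lambda>(p, \<alpha>, \<gamma>, \<epsilon>). P p (\<alpha> * n + \<gamma> + \<epsilon> * x)) (atoms c) =
    restrict (\<lambda>(p, \<alpha>, \<gamma>, \<epsilon>). P' p (\<alpha> * n' + \<gamma> + \<epsilon> * x')) (atoms c)"
    by (rule encode_eqD[OF finite_atom_types[of c]])
      (use assms(1) in \<open>simp_all add: atom_types_def\<close>)
  from fun_cong[OF this, of "(p, \<alpha>, \<gamma>, \<epsilon>)"] show ?thesis
    using assms(2-5) by (simp add: atoms_def)
qed

lemma type_of_Suc_eqD:
  assumes "type_of c n P (Suc m) x = type_of c n' P' (Suc m) x'"
  shows "type_of c n P m x = type_of c n' P' m x'"
    and "\<alpha> \<in> coeffs c \<Longrightarrow> \<beta> \<in> coeffs c \<Longrightarrow> \<gamma> \<in> coeffs c \<Longrightarrow> \<delta> \<in> coeffs c \<Longrightarrow> \<epsilon> \<in> signs \<Longrightarrow>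
      type_of c n P m ` {\<alpha> * n + \<beta>..\<gamma> * n + \<delta> + \<epsilon> * x} =
      type_of c n' P' m ` {\<alpha> * n' + \<beta>..\<gamma> * n' + \<delta> + \<epsilon> * x'}"
proof -
  have *: "(type_of c n P m x,
      restrict (\<lambda>(\<alpha>, \<beta>, \<gamma>, \<delta>, \<epsilon>). type_of c n P m ` {\<alpha> * n + \<beta>..\<gamma> * n + \<delta> + \<epsilon> * x}) (bounds c)) =
    (type_of c n' P' m x',
      restrict (\<lambda>(\<alpha>, \<beta>, \<gamma>, \<delta>, \<epsilon>). type_of c n' P' m ` {\<alpha> * n' + \<beta>..\<gamma> * n' + \<delta> + \<epsilon> * x'}) (bounds c))"
    by (rule encode_eqD[OF finite_iter_types[of c "num_types c m"]])
      (use assms in \<open>auto simp: iter_types_def type_of_less\<close>)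
  then show "type_of c n P m x = type_of c n' P' m x'" by simp
  assume "\<alpha> \<in> coeffs c" "\<beta> \<in> coeffs c" "\<gamma> \<in> coeffs c" "\<delta> \<in> coeffs c" "\<epsilon> \<in> signs"
  then show "type_of c n P m ` {\<alpha> * n + \<beta>..\<gamma> * n + \<delta> + \<epsilon> * x} =
      type_of c n' P' m ` {\<alpha> * n' + \<beta>..\<gamma> * n' + \<delta> + \<epsilon> * x'}"
    using fun_cong[OF arg_cong[OF *, of snd], of "(\<alpha>, \<beta>, \<gamma>, \<delta>, \<epsilon>)"] by (simp add: bounds_def)
qed

lemma type_of_le_eqD:
  assumes "type_of c n P m x = type_of c n' P' m x'" "k \<le> m"
  shows "type_of c n P k x = type_of c n' P' k x'"
  using assms(2,1) by (induction rule: inc_induct) (auto dest: type_of_Suc_eqD(1) simp del: type_of.simps)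

section \<open>Types determine truth\<close>

lemma type_of_range_eq:
  assumes "param_term c v a" "index_term c v b" "e v = n" "e' v = n'"
    and "type_of c n P (Suc l) 0 = type_of c n' P' (Suc l) 0"
    and "\<And>u. u \<in> avars b - {v} \<Longrightarrow> type_of c n P (Suc l) (e u) = type_of c n' P' (Suc l) (e' u)"
  shows "type_of c n P l ` {aval e a..aval e b} = type_of c n' P' l ` {aval e' a..aval e' b}"
proof -
  obtain \<alpha> \<beta> where a: "\<alpha> \<in> coeffs c" "\<beta> \<in> coeffs c" "\<And>e. aval e a = \<alpha> * e v + \<beta>"
    using assms(1) by (auto simp: param_term_def mem_coeffs)
  obtain \<gamma> \<delta> \<epsilon> j where b: "\<gamma> \<in> coeffs c" "\<delta> \<in> coeffs c" "\<epsilon> \<in> signs"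
    and j: "\<epsilon> = 0 \<or> j \<in> avars b - {v}" and bv: "\<And>e. aval e b = \<gamma> * e v + \<delta> + \<epsilon> * e j"
    using assms(2) by (auto simp: index_term_def mem_coeffs signs_def)
  \<comment> \<open>A bound without bound variable is read as one at the value 0, which is where the
    hypothesis on the types of 0 enters.\<close>
  define x x' where "x = (if \<epsilon> = 0 then 0 else e j)" and "x' = (if \<epsilon> = 0 then 0 else e' j)"
  have "type_of c n P (Suc l) x = type_of c n' P' (Suc l) x'"
    using assms(5,6) j by (auto simp: x_def x'_def simp del: type_of.simps)
  from type_of_Suc_eqD(2)[OF this a(1,2) b] show ?thesis
    using assms(3,4) by (simp add: a(3) bv x_def x'_def split: if_splits)
qed

lemma ball_cong_image:
  assumes "f ` A = g ` B" "\<And>x y. f x = g y \<Longrightarrow> p x = q y"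
  shows "(\<forall>x\<in>A. p x) = (\<forall>y\<in>B. q y)"
  using assms by (metis imageE imageI)

lemma bex_cong_image:
  assumes "f ` A = g ` B" "\<And>x y. f x = g y \<Longrightarrow> p x = q y"
  shows "(\<exists>x\<in>A. p x) = (\<exists>y\<in>B. q y)"
  using assms by (metis imageE imageI)

text \<open>A back-and-forth argument in which every iteration costs one rank: equal types of rank
  \<open>Suc l\<close> yield equal sets of types of rank \<open>l\<close> on the two ranges, so each
  value on one side has a partner of the same type on the other. Partners can be chosen one variable
  at a time because no atom and no bound relates two bound variables.\<close>

lemma truth_eq_if_type_of_eq:
  assumes "\<And>\<alpha> \<gamma>. \<bar>\<gamma>\<bar> \<le> int c \<Longrightarrow> 0 < \<alpha> * n + \<gamma> \<longleftrightarrow> 0 < \<alpha> * n' + \<gamma>"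
    and "uniform c v f" "depth f \<le> m" "e v = n" "e' v = n'"
    and "type_of c n P m 0 = type_of c n' P' m 0"
    and "\<And>u. u \<in> free_vars f - {v} \<Longrightarrow> type_of c n P m (e u) = type_of c n' P' m (e' u)"
  shows "truth P f e = truth P' f e'"
  using assms(2-)
proof (induction f arbitrary: m e e')
  case (Less a b)
  then obtain \<alpha> \<gamma> where "\<bar>\<gamma>\<bar> \<le> int c" and *: "\<And>e. aval e b - aval e a = \<alpha> * e v + \<gamma>" by auto
  have "aval e a < aval e b \<longleftrightarrow> 0 < \<alpha> * n + \<gamma>" "aval e' a < aval e' b \<longleftrightarrow> 0 < \<alpha> * n' + \<gamma>"
    using *[of e] *[of e'] Less.prems(3,4) by auto
  then show ?case using assms(1)[OF \<open>\<bar>\<gamma>\<bar> \<le> int c\<close>, of \<alpha>] by simp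
next
  case (IProp p a)
  then obtain \<alpha> \<gamma> \<epsilon> j where pa: "p \<le> c" "\<alpha> \<in> coeffs c" "\<gamma> \<in> coeffs c" "\<epsilon> \<in> signs"
    and j: "\<epsilon> = 0 \<or> j \<in> avars a - {v}" and av: "\<And>e. aval e a = \<alpha> * e v + \<gamma> + \<epsilon> * e j"
    by (auto simp: index_term_def mem_coeffs signs_def)
  define x x' where "x = (if \<epsilon> = 0 then 0 else e j)" and "x' = (if \<epsilon> = 0 then 0 else e' j)"
  have "type_of c n P m x = type_of c n' P' m x'"
    using IProp.prems(5,6) j by (auto simp: x_def x'_def simp del: type_of.simps)
  then have "type_of c n P 0 x = type_of c n' P' 0 x'"
    by (rule type_of_le_eqD) simp
  from type_of_0_eqD[OF this pa] show ?case
    using IProp.prems(3,4) by (simp add: av x_def x'_def split: if_splits)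
next
  case (Or f g)
  have "truth P f e = truth P' f e'" by (rule Or.IH(1)) (use Or.prems in auto)
  moreover have "truth P g e = truth P' g e'" by (rule Or.IH(2)) (use Or.prems in auto)
  ultimately show ?case by simp
next
  case (And f g)
  have "truth P f e = truth P' f e'" by (rule And.IH(1)) (use And.prems in auto)
  moreover have "truth P g e = truth P' g e'" by (rule And.IH(2)) (use And.prems in auto)
  ultimately show ?case by simp
next
  case (Neg f)
  have "truth P f e = truth P' f e'" by (rule Neg.IH) (use Neg.prems in auto)
  then show ?case by simp
next
  case (BigAnd i a b f)
  obtain l where m: "m = Suc l" using BigAnd.prems(2) by (cases m) auto
  have img: "type_of c n P l ` {aval e a..aval e b} = type_of c n' P' l ` {aval e' a..aval e' b}"
    using BigAnd.prems unfolding m by (intro type_of_range_eq[of c v]) auto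
  have *: "truth P f (e(i := k)) = truth P' f (e'(i := k'))"
    if k: "type_of c n P l k = type_of c n' P' l k'" for k k'
  proof (rule BigAnd.IH)
    show "type_of c n P l 0 = type_of c n' P' l 0"
      using BigAnd.prems(5) unfolding m by (rule type_of_Suc_eqD)
    show "type_of c n P l ((e(i := k)) u) = type_of c n' P' l ((e'(i := k')) u)"
      if "u \<in> free_vars f - {v}" for u
    proof (cases "u = i")
      case False
      then have "type_of c n P (Suc l) (e u) = type_of c n' P' (Suc l) (e' u)"
        using that BigAnd.prems(6) unfolding m by auto
      from type_of_Suc_eqD(1)[OF this] show ?thesis using False by simp
    qed (use k in simp)
  qed (use BigAnd.prems m in auto)
  show ?case unfolding truth.simps using * by (rule ball_cong_image[OF img])
next
  case (BigOr i a b f)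
  obtain l where m: "m = Suc l" using BigOr.prems(2) by (cases m) auto
  have img: "type_of c n P l ` {aval e a..aval e b} = type_of c n' P' l ` {aval e' a..aval e' b}"
    using BigOr.prems unfolding m by (intro type_of_range_eq[of c v]) auto
  have *: "truth P f (e(i := k)) = truth P' f (e'(i := k'))"
    if k: "type_of c n P l k = type_of c n' P' l k'" for k k'
  proof (rule BigOr.IH)
    show "type_of c n P l 0 = type_of c n' P' l 0"
      using BigOr.prems(5) unfolding m by (rule type_of_Suc_eqD)
    show "type_of c n P l ((e(i := k)) u) = type_of c n' P' l ((e'(i := k')) u)"
      if "u \<in> free_vars f - {v}" for u
    proof (cases "u = i")
      case False
      then have "type_of c n P (Suc l) (e u) = type_of c n' P' (Suc l) (e' u)"
        using that BigOr.prems(6) unfolding m by auto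
      from type_of_Suc_eqD(1)[OF this] show ?thesis using False by simp
    qed (use k in simp)
  qed (use BigOr.prems m in auto)
  show ?case unfolding truth.simps using * by (rule bex_cong_image[OF img])
qed auto

section \<open>Shrinking the parameter\<close>

text \<open>A deleted segment of length \<open>d\<close> begins right after \<open>r\<close>, and
  \<open>w\<close> is the largest shift considered across a joint. The inequalities keep
  neighbouring joints, also those on the two sides of a multiple of the period, so far apart that
  such a shift crosses at most one.\<close>

locale cut =
  fixes n d r w :: int
  assumes d: "0 < d" and w: "1 \<le> w" "w \<le> r" and r: "2 * r + w < n - 2 * d"
begin

definition n' :: int where
  "n' = n - 2 * d"

text \<open>\<open>emb\<close> skips, in every period, the segments \<open>(r, r + d]\<close> and \<open>[n - r - d, n - r)\<close>. It commutes
  with translation by the period and with negation, which is why the deleted segments come in mirror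
  pairs.\<close>

definition emb0 :: "int \<Rightarrow> int" where
  "emb0 z = (if z \<le> r then z else if z < n' - r then z + d else z + 2 * d)"

definition emb :: "int \<Rightarrow> int" where
  "emb x = x div n' * n + emb0 (x mod n')"

lemma n'_gt: "2 * r + w < n'"
  using r by (simp add: n'_def)

lemma n'_pos: "0 < n'"
  using n'_gt w by linarith

lemma emb_eq: "0 \<le> z \<Longrightarrow> z < n' \<Longrightarrow> emb (q * n' + z) = q * n + emb0 z"
  using n'_pos by (simp add: emb_def)

lemma decompose:
  obtains q z where "x = q * n' + z" "0 \<le> z" "z < n'"
  using n'_pos pos_mod_bound[of n' x] pos_mod_sign[of n' x] div_mult_mod_eq[of x n'] by metis

lemma emb_add: "emb (q * n' + x) = q * n + emb x"
proof -
  obtain k z where x: "x = k * n' + z" "0 \<le> z" "z < n'" by (rule decompose)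
  have "emb (q * n' + x) = (q + k) * n + emb0 z"
    using emb_eq[OF x(2,3), of "q + k"] by (simp add: x(1) algebra_simps)
  then show ?thesis using emb_eq[OF x(2,3), of k] by (simp add: x(1) algebra_simps)
qed

lemma emb_small:
  assumes "\<bar>x\<bar> \<le> r"
  shows "emb x = x"
proof (cases "0 \<le> x")
  case True
  then show ?thesis using emb_eq[of x 0] assms n'_gt w by (simp add: emb0_def)
next
  case False
  then show ?thesis using emb_eq[of "n' + x" "-1"] assms n'_gt w by (simp add: emb0_def n'_def)
qed

text \<open>Reflection z to n' - z exchanges the condition \<open>z \<le> r\<close> with the failure
  of \<open>z < n' - r\<close>; this is why one comparison in \<open>emb0\<close> is strict and the
  other is not. The residue 0 is treated apart because its reflection is not a residue.\<close>

lemma emb_uminus: "emb (- x) = - emb x"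
proof -
  obtain q z where x: "x = q * n' + z" "0 \<le> z" "z < n'" by (rule decompose)
  show ?thesis
  proof (cases "z = 0")
    case True
    then have "emb x = q * n" "emb (- x) = - q * n"
      using emb_eq[of 0 q] emb_eq[of 0 "- q"] x n'_pos w by (simp_all add: emb0_def)
    then show ?thesis by simp
  next
    case False
    have x': "- x = (- q - 1) * n' + (n' - z)" by (simp add: x(1) algebra_simps)
    have "emb (- x) = (- q - 1) * n + emb0 (n' - z)"
      unfolding x' by (rule emb_eq) (use False x in auto)
    moreover have "emb x = q * n + emb0 z" using emb_eq[of z q] x by simp
    moreover have "emb0 (n' - z) = n - emb0 z"
      using n'_gt w x False n'_def unfolding emb0_def by (smt (verit))
    ultimately show ?thesis by (simp add: algebra_simps)
  qed
qed

lemma emb_sign: "\<epsilon> \<in> signs \<Longrightarrow> emb (\<epsilon> * x) = \<epsilon> * emb x"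
  using emb_uminus[of x] emb_small[of 0] w by (auto simp: signs_def)

lemma emb_less_Suc: "emb x < emb (x + 1)"
proof -
  obtain q z where x: "x = q * n' + z" "0 \<le> z" "z < n'" by (rule decompose)
  have ex: "emb x = q * n + emb0 z" using emb_eq[of z q] x by simp
  show ?thesis
  proof (cases "z + 1 < n'")
    case True
    have "emb (x + 1) = q * n + emb0 (z + 1)"
      using emb_eq[of "z + 1" q] x True by (simp add: add.assoc)
    then show ?thesis using ex d by (simp add: emb0_def)
  next
    case False
    then have z: "z = n' - 1" using x by simp
    have "emb (x + 1) = (q + 1) * n + emb0 0"
      using emb_eq[of 0 "q + 1"] x z n'_pos by (simp add: algebra_simps)
    moreover have "emb0 0 = 0" "emb0 z = n - 1"
      using n'_gt w n'_def by (auto simp: z emb0_def)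
    ultimately show ?thesis using ex by (simp add: algebra_simps)
  qed
qed

lemma emb_strict_mono: "x < y \<Longrightarrow> emb x < emb y"
proof (induction y rule: int_gr_induct)
  case (step i)
  then show ?case using emb_less_Suc[of i] by linarith
qed (rule emb_less_Suc)

text \<open>The two ends of a deleted segment are indistinguishable for \<open>F\<close> within
  distance \<open>w\<close>. The sign \<open>s = -1\<close> accounts for the mirror segment below
  \<open>q * n\<close>.\<close>

definition agree :: "int \<Rightarrow> (int \<Rightarrow> 'a) \<Rightarrow> bool" where
  "agree K F \<longleftrightarrow> (\<forall>q s t. \<bar>q\<bar> \<le> K \<longrightarrow> s \<in> {-1, 1} \<longrightarrow> \<bar>t\<bar> \<le> w \<longrightarrow>
     F (q * n + s * (r + t)) = F (q * n + s * (r + d + t)))"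

text \<open>If no joint lies between x and x + t, then \<open>emb\<close> shifts both by the same
  amount and the two arguments are equal. Across a joint they differ by d and sit at the same offset
  from the two ends of the deleted segment, where \<open>F\<close> agrees. The inequality
  \<open>L < K\<close> is strict because the upper segment of period q is the mirror segment of the
  multiple q + 1.\<close>

lemma glue:
  assumes F: "agree K F" and x: "\<bar>x\<bar> \<le> L * n'" and t: "\<bar>t\<bar> \<le> w" and K: "L < K"
  shows "F (emb (x + t)) = F (emb x + t)"
proof -
  obtain q z where xz: "x = q * n' + z" "0 \<le> z" "z < n'" by (rule decompose)
  have "q * n' < (L + 1) * n'" "(- L - 1) * n' < q * n'"
    using x xz by (simp_all add: algebra_simps)
  then have q: "\<bar>q\<bar> \<le> K" "\<bar>q + 1\<bar> \<le> K"
    using n'_pos K by (simp_all only: mult_less_cancel_right) linarith+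
  have emb_x: "emb x = q * n + emb0 z" using emb_eq xz by simp
  have left: "F (q * n + (r + t)) = F (q * n + (r + d + t))" if "\<bar>t\<bar> \<le> w" for t
    using F q that unfolding agree_def by fastforce
  have right: "F (q * n + n - r + t) = F (q * n + n - r - d + t)" if "\<bar>t\<bar> \<le> w" for t
  proof -
    have "F ((q + 1) * n + (- 1) * (r + - t)) = F ((q + 1) * n + (- 1) * (r + d + - t))"
      using F q(2) that unfolding agree_def by (metis abs_minus_cancel insertI1)
    then show ?thesis by (simp add: algebra_simps)
  qed
  consider "z + t < 0" | "n' \<le> z + t" | "0 \<le> z + t" "z + t < n'" by linarith
  then show ?thesis
  proof cases
    case 1
    have "emb (x + t) = (q - 1) * n + emb0 (n' + z + t)"
      using emb_eq[of "n' + z + t" "q - 1"] 1 xz t n'_gt w by (simp add: algebra_simps)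
    moreover have "emb0 (n' + z + t) = n + z + t" "emb0 z = z"
      using 1 xz t n'_gt w n'_def by (auto simp: emb0_def)
    ultimately show ?thesis using emb_x by (simp add: algebra_simps)
  next
    case 2
    have "emb (x + t) = (q + 1) * n + emb0 (z + t - n')"
      using emb_eq[of "z + t - n'" "q + 1"] 2 xz t n'_gt w by (simp add: algebra_simps)
    moreover have "emb0 (z + t - n') = z + t - n'" "emb0 z = z + 2 * d"
      using 2 xz t n'_gt w by (auto simp: emb0_def)
    ultimately have "emb (x + t) = emb x + t"
      using emb_x n'_def distrib_right[of q 1 n] by linarith
    then show ?thesis by simp
  next
    case 3
    have emb_xt: "emb (x + t) = q * n + emb0 (z + t)"
      using emb_eq[of "z + t" q] 3 xz by (simp add: add.assoc)
    consider (same) "emb0 (z + t) = emb0 z + t"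
      | (l1) "z \<le> r" "emb0 z = z" "emb0 (z + t) = z + t + d" "r < z + t"
      | (l2) "r < z" "emb0 z = z + d" "emb0 (z + t) = z + t" "z + t \<le> r"
      | (r1) "z < n' - r" "emb0 z = z + d" "emb0 (z + t) = z + t + 2 * d" "n' - r \<le> z + t"
      | (r2) "n' - r \<le> z" "emb0 z = z + 2 * d" "emb0 (z + t) = z + t + d" "z + t < n' - r"
      using t n'_gt w unfolding emb0_def by (smt (verit))
    then show ?thesis
    proof cases
      case same
      then show ?thesis using emb_x emb_xt by (simp add: add.assoc)
    next
      case l1
      then show ?thesis using left[of "z + t - r"] t emb_x emb_xt by (simp add: algebra_simps)
    next
      case l2
      then show ?thesis using left[of "z + t - r"] t emb_x emb_xt by (simp add: algebra_simps)
    next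
      case r1
      then show ?thesis using right[of "z + t - (n' - r)"] t emb_x emb_xt by (simp add: algebra_simps n'_def)
    next
      case r2
      then show ?thesis using right[of "z + t - (n' - r)"] t emb_x emb_xt by (simp add: algebra_simps n'_def)
    qed
  qed
qed

definition agree_types :: "int \<Rightarrow> nat \<Rightarrow> (psym \<Rightarrow> int \<Rightarrow> bool) \<Rightarrow> bool" where
  "agree_types K c P \<longleftrightarrow> (\<forall>p\<le>c. agree K (P p)) \<and>
     (\<forall>m\<le>c. \<forall>\<alpha>\<in>coeffs c. \<forall>\<beta>\<in>coeffs c. agree K (\<lambda>y. type_of c n P m ` {\<alpha> * n + \<beta>..y}))"

text \<open>By induction on the upper end. Where \<open>emb\<close> jumps, \<open>glue\<close> with
  t = -1 shows that the sets up to \<open>emb y\<close> and up to \<open>emb (y + 1) - 1\<close>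
  coincide, so the skipped integers contribute nothing new. The lower ends correspond exactly, since
  \<beta> is too small to reach a joint from a multiple of the period.\<close>

lemma type_of_range_emb:
  assumes agree: "agree K (\<lambda>y. type_of c n P m ` {\<alpha> * n + \<beta>..y})" and K: "L < K"
    and IH: "\<And>x. \<bar>x\<bar> \<le> L * n' \<Longrightarrow> type_of c n' P' m x = type_of c n P m (emb x)"
    and low: "\<bar>\<alpha> * n' + \<beta>\<bar> \<le> L * n'" and \<beta>: "\<bar>\<beta>\<bar> \<le> w" and y: "y \<le> L * n'"
  shows "type_of c n' P' m ` {\<alpha> * n' + \<beta>..y} = type_of c n P m ` {\<alpha> * n + \<beta>..emb y}"
proof -
  have emb_low: "emb (\<alpha> * n' + \<beta>) = \<alpha> * n + \<beta>"
    using emb_add[of \<alpha> \<beta>] emb_small[of \<beta>] \<beta> w by simp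
  show ?thesis
  proof (cases "\<alpha> * n' + \<beta> \<le> y")
    case False
    then have "emb y < \<alpha> * n + \<beta>" using emb_strict_mono[of y "\<alpha> * n' + \<beta>"] emb_low by simp
    then show ?thesis using False by simp
  next
    case True
    then show ?thesis using y
    proof (induction y rule: int_ge_induct)
      case base
      then show ?case using IH[OF low] emb_low by simp
    next
      case (step y)
      then have y: "\<bar>y + 1\<bar> \<le> L * n'" using low by linarith
      have "{\<alpha> * n' + \<beta>..y + 1} = insert (y + 1) {\<alpha> * n' + \<beta>..y}" using step by auto
      moreover have "{\<alpha> * n + \<beta>..emb (y + 1)} = insert (emb (y + 1)) {\<alpha> * n + \<beta>..emb (y + 1) - 1}"
        using emb_strict_mono[of "\<alpha> * n' + \<beta>" "y + 1"] emb_low step by auto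
      moreover have "type_of c n P m ` {\<alpha> * n + \<beta>..emb y} = type_of c n P m ` {\<alpha> * n + \<beta>..emb (y + 1) - 1}"
        using glue[OF agree y _ K, of "-1"] w by simp
      ultimately show ?case using step IH[OF y] by simp
    qed
  qed
qed

text \<open>The ends of a range exceed the enclosing value x in absolute value by at most c n' + c
  \<le> 2 c n'. So each rank given up widens the admissible radius by 2 c n', which explains the
  factor \<open>int c + 1 - int m\<close>. The extra summand \<open>int c\<close> below
  \<open>K\<close> pays for the multiples of n in atoms.\<close>

lemma type_of_emb:
  assumes agree: "agree_types K c P" and P': "P' = (\<lambda>p x. P p (emb x))"
    and c: "int c \<le> w" and K: "2 * int c * (int c + 1) + int c < K"
    and m: "m \<le> c" and x: "\<bar>x\<bar> \<le> 2 * int c * (int c + 1 - int m) * n'"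
  shows "type_of c n' P' m x = type_of c n P m (emb x)"
  using m x
proof (induction m arbitrary: x)
  case 0
  have "P' p (\<alpha> * n' + \<gamma> + \<epsilon> * x) = P p (\<alpha> * n + \<gamma> + \<epsilon> * emb x)"
    if "(p, \<alpha>, \<gamma>, \<epsilon>) \<in> atoms c" for p \<alpha> \<gamma> \<epsilon>
  proof -
    from that have *: "p \<le> c" "\<bar>\<alpha>\<bar> \<le> int c" "\<bar>\<gamma>\<bar> \<le> int c" "\<epsilon> \<in> signs" by (auto simp: atoms_def mem_coeffs)
    have "\<bar>\<epsilon> * x\<bar> \<le> 2 * int c * (int c + 1) * n'"
    proof -
      have "\<bar>\<epsilon> * x\<bar> \<le> \<bar>x\<bar>" using *(4) by (auto simp: signs_def)
      then show ?thesis using 0 by simp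
    qed
    moreover have "\<bar>\<alpha> * n'\<bar> \<le> int c * n'" using *(2) n'_pos by (simp add: abs_mult)
    ultimately have "\<bar>\<alpha> * n' + \<epsilon> * x\<bar> \<le> (2 * int c * (int c + 1) + int c) * n'"
      unfolding distrib_right by linarith
    \<comment> \<open>\<open>emb\<close> commutes with multiples of the period and with signs, but
      not with adding \<gamma>; the two sides agree only after \<open>P p\<close> has been
      applied.\<close>
    then have "P p (emb (\<alpha> * n' + \<epsilon> * x + \<gamma>)) = P p (emb (\<alpha> * n' + \<epsilon> * x) + \<gamma>)"
      using agree * c by (intro glue[OF _ _ _ K]) (auto simp: agree_types_def)
    then have "P p (emb (\<alpha> * n' + \<epsilon> * x + \<gamma>)) = P p (\<alpha> * n + \<epsilon> * emb x + \<gamma>)"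
      using emb_add emb_sign[OF *(4)] by simp
    then show ?thesis by (simp add: P' ac_simps)
  qed
  then show ?case
    unfolding type_of.simps by (intro arg_cong[of _ _ "encode _"] restrict_ext) auto
next
  case (Suc m)
  let ?L = "2 * int c * (int c + 1 - int m)"
  have m: "m \<le> c" "Suc m \<le> c" using Suc.prems by auto
  have L: "?L = 2 * int c * (int c + 1 - int (Suc m)) + 2 * int c"
    by (simp add: algebra_simps)
  have L_le: "?L \<le> 2 * int c * (int c + 1)" by (intro mult_left_mono) auto
  have L_ge: "2 * int c \<le> ?L" using mult_left_mono[of 1 "int c + 1 - int m" "2 * int c"] m by simp
  have x: "\<bar>x\<bar> + 2 * int c * n' \<le> ?L * n'"
    using Suc.prems(2) unfolding L distrib_right by linarith
  have c_le: "int c \<le> int c * n'" using n'_pos mult_left_mono[of 1 n' "int c"] by simp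
  have IH: "type_of c n' P' m x = type_of c n P m (emb x)" if "\<bar>x\<bar> \<le> ?L * n'" for x
    using Suc.IH[of x] m that by simp
  have "type_of c n' P' m ` {\<alpha> * n' + \<beta>..\<gamma> * n' + \<delta> + \<epsilon> * x} =
      type_of c n P m ` {\<alpha> * n + \<beta>..\<gamma> * n + \<delta> + \<epsilon> * emb x}"
    if "(\<alpha>, \<beta>, \<gamma>, \<delta>, \<epsilon>) \<in> bounds c" for \<alpha> \<beta> \<gamma> \<delta> \<epsilon>
  proof -
    from that have *: "\<alpha> \<in> coeffs c" "\<beta> \<in> coeffs c" "\<bar>\<alpha>\<bar> \<le> int c" "\<bar>\<beta>\<bar> \<le> int c"
      "\<bar>\<gamma>\<bar> \<le> int c" "\<bar>\<delta>\<bar> \<le> int c" "\<epsilon> \<in> signs"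
      by (auto simp: bounds_def mem_coeffs)
    have agr: "agree K (\<lambda>y. type_of c n P m ` {\<alpha> * n + \<beta>..y})"
      using agree m * by (simp add: agree_types_def)
    have ep: "\<bar>\<epsilon> * x\<bar> \<le> \<bar>x\<bar>" using *(7) by (auto simp: signs_def)
    have al: "\<bar>\<alpha> * n'\<bar> \<le> int c * n'" and ga: "\<bar>\<gamma> * n'\<bar> \<le> int c * n'"
      using *(3,5) n'_pos by (simp_all add: abs_mult)
    have "2 * int c * n' \<le> ?L * n'" using L_ge n'_pos by (intro mult_right_mono) auto
    then have low: "\<bar>\<alpha> * n' + \<beta>\<bar> \<le> ?L * n'" using al c_le *(4) by linarith
    have y: "\<bar>\<gamma> * n' + \<epsilon> * x\<bar> \<le> ?L * n'" "\<gamma> * n' + \<delta> + \<epsilon> * x \<le> ?L * n'"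
      using ga ep x c_le *(6) by linarith+
    have "type_of c n' P' m ` {\<alpha> * n' + \<beta>..\<gamma> * n' + \<delta> + \<epsilon> * x} =
      type_of c n P m ` {\<alpha> * n + \<beta>..emb (\<gamma> * n' + \<delta> + \<epsilon> * x)}"
      using L_le K c *(4) y(2) by (intro type_of_range_emb[OF agr _ IH low]) auto
    also have "\<dots> = type_of c n P m ` {\<alpha> * n + \<beta>..emb (\<gamma> * n' + \<epsilon> * x) + \<delta>}"
      using glue[OF agr y(1), of \<delta>] *(6) c L_le K by (simp add: ac_simps)
    also have "emb (\<gamma> * n' + \<epsilon> * x) + \<delta> = \<gamma> * n + \<delta> + \<epsilon> * emb x"
      using emb_add emb_sign[OF *(7)] by simp
    finally show ?thesis .
  qed
  moreover have "type_of c n' P' m x = type_of c n P m (emb x)"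
    using IH[of x] x n'_pos by (smt (verit) mult_nonneg_nonneg of_nat_0_le_iff)
  ultimately show ?case
    unfolding type_of.simps by (intro arg_cong[of _ _ "encode _"] arg_cong2[of _ _ _ _ Pair] restrict_ext)
      (assumption | clarify, simp only: prod.case)+
qed

lemma truth_emb:
  assumes "agree_types K c P" "int c \<le> w" "2 * int c * (int c + 1) + int c < K"
    and f: "uniform c v f" "depth f \<le> c" "free_vars f \<subseteq> {v}" and e: "e v = n" "e' v = n'"
  shows "truth P f e = truth (\<lambda>p x. P p (emb x)) f e'"
proof (rule truth_eq_if_type_of_eq[where n = n and n' = n' and e = e and e' = e', OF _ f(1,2) e])
  have "int c < n'" "int c < n" using n'_gt w assms(2) d by (simp_all add: n'_def)
  \<comment> \<open>Beyond \<open>c\<close> the constant cannot outweigh a nonzero multiple of the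
    parameter, so the arithmetic atoms have the same truth values for n and n'.\<close>
  have *: "0 < \<alpha> * k + \<gamma> \<longleftrightarrow> 0 < \<alpha> \<or> \<alpha> = 0 \<and> 0 < \<gamma>" if "\<bar>\<gamma>\<bar> \<le> int c" "int c < k" for \<alpha> \<gamma> k :: int
  proof -
    consider "1 \<le> \<alpha>" | "\<alpha> = 0" | "\<alpha> \<le> -1" by linarith
    then show ?thesis
    proof cases
      case 1
      then have "1 * k \<le> \<alpha> * k" using that by (intro mult_right_mono) auto
      then show ?thesis using that 1 by linarith
    next
      case 3
      then have "\<alpha> * k \<le> -1 * k" using that by (intro mult_right_mono) auto
      then show ?thesis using that 3 by linarith
    qed simp
  qed
  show "0 < \<alpha> * n + \<gamma> \<longleftrightarrow> 0 < \<alpha> * n' + \<gamma>" if "\<bar>\<gamma>\<bar> \<le> int c" for \<alpha> \<gamma>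
    using *[OF that \<open>int c < n\<close>] *[OF that \<open>int c < n'\<close>] by blast
  show "type_of c n P c 0 = type_of c n' (\<lambda>p x. P p (emb x)) c 0"
    using type_of_emb[OF assms(1) refl assms(2,3), of c 0] emb_small[of 0] w n'_pos by simp
qed (use f(3) in auto)

end

text \<open>Everything that \<open>agree_types\<close> inspects near the places
  \<open>q * n + r\<close> and \<open>q * n - r\<close>, packed into one value. Equal columns at r
  and r + d give the agreement required for deleting the segment between them.\<close>

definition column :: "nat \<Rightarrow> nat \<Rightarrow> int \<Rightarrow> (psym \<Rightarrow> int \<Rightarrow> bool) \<Rightarrow> int \<Rightarrow>
    (nat \<times> int \<times> int \<times> int \<Rightarrow> bool) \<times> (nat \<times> int \<times> int \<times> int \<times> int \<times> int \<Rightarrow> nat set)" where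
  "column c K n P r =
    (restrict (\<lambda>(p, q, s, t). P p (q * n + s * (r + t))) ({..c} \<times> coeffs K \<times> {-1, 1} \<times> coeffs c),
     restrict (\<lambda>(m, \<alpha>, \<beta>, q, s, t). type_of c n P m ` {\<alpha> * n + \<beta>..q * n + s * (r + t)})
       ({..c} \<times> coeffs c \<times> coeffs c \<times> coeffs K \<times> {-1, 1} \<times> coeffs c))"

text \<open>The number of pairs of functions that can occur as columns. All ranks up to
  \<open>c\<close> share the bound \<open>num_types c c\<close>, as the number of types does not
  decrease with the rank.\<close>

definition num_columns :: "nat \<Rightarrow> nat \<Rightarrow> nat" where
  "num_columns c K = 2 ^ ((c + 1) * ((2 * K + 1) * (2 * (2 * c + 1)))) *
     (2 ^ num_types c c) ^ ((c + 1) * ((2 * c + 1) * ((2 * c + 1) * ((2 * K + 1) * (2 * (2 * c + 1))))))"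

lemma num_types_mono: "m \<le> k \<Longrightarrow> num_types c m \<le> num_types c k"
proof (induction k rule: dec_induct)
  case (step k)
  have "num_types c k * 1 \<le> num_types c (Suc k)"
    unfolding num_types.simps by (intro mult_left_mono) auto
  then show ?case using step by linarith
qed simp

lemma columns_eq:
  obtains i j where "i < j" "j \<le> num_columns c K"
    "column c K n P (a + int i) = column c K n P (a + int j)"
proof -
  let ?A = "PiE ({..c} \<times> coeffs K \<times> {-1, 1 :: int} \<times> coeffs c) (\<lambda>_. UNIV :: bool set)"
  let ?B = "PiE ({..c} \<times> coeffs c \<times> coeffs c \<times> coeffs K \<times> {-1, 1 :: int} \<times> coeffs c) (\<lambda>_. Pow {..<num_types c c})"
  have card: "finite (?A \<times> ?B)" "card (?A \<times> ?B) = num_columns c K"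
    by (auto intro!: finite_PiE simp: num_columns_def card_cartesian_product card_PiE card_coeffs card_Pow)
  have "type_of c n P m x < num_types c c" if "m \<le> c" for m x
    using type_of_less[of c n P m x] num_types_mono[OF that, of c] by linarith
  then have "(\<lambda>i. column c K n P (a + int i)) ` {..num_columns c K} \<subseteq> ?A \<times> ?B"
    unfolding column_def
    by (intro image_subsetI SigmaI; subst restrict_PiE_iff; auto)
  from card_mono[OF card(1) this]
  have "card ((\<lambda>i. column c K n P (a + int i)) ` {..num_columns c K}) < card {..num_columns c K}"
    by (simp only: card(2) card_atMost less_Suc_eq_le)
  then have "\<not> inj_on (\<lambda>i. column c K n P (a + int i)) {..num_columns c K}"
    by (rule pigeonhole)
  then obtain i j where ij: "i \<le> num_columns c K" "j \<le> num_columns c K" "i \<noteq> j"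
    "column c K n P (a + int i) = column c K n P (a + int j)"
    by (auto simp: inj_on_def)
  then show ?thesis using that[of i j] that[of j i] by (cases "i < j") auto
qed

definition threshold :: "nat \<Rightarrow> nat" where
  "threshold c = 2 * num_columns c (2 * c * (c + 1) + c + 1) + 3 * c"

lemma truth_pump:
  assumes c: "1 \<le> c" and f: "uniform c v f" "depth f \<le> c" "free_vars f \<subseteq> {v}"
    and e: "truth P f e" "int (threshold c) < e v"
  obtains P' e' where "truth P' f e'" "0 \<le> e' v" "e' v < e v"
proof -
  let ?K = "2 * c * (c + 1) + c + 1" and ?n = "e v"
  \<comment> \<open>The places start at \<open>c\<close> so that r is at least the window
    width.\<close>
  obtain i j where ij: "i < j" "j \<le> num_columns c ?K"
    "column c ?K ?n P (int c + int i) = column c ?K ?n P (int c + int j)"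
    by (rule columns_eq)
  interpret cut ?n "int j - int i" "int c + int i" "int c"
    by unfold_locales (use c ij e(2) in \<open>simp_all add: threshold_def\<close>)
  have P: "P p (q * ?n + s * (int c + int i + t)) = P p (q * ?n + s * (int c + int j + t))"
    if "p \<le> c" "\<bar>q\<bar> \<le> int ?K" "s \<in> {-1, 1}" "\<bar>t\<bar> \<le> int c" for p q s t
    using fun_cong[OF arg_cong[OF ij(3), of fst], of "(p, q, s, t)"] that
    by (simp add: column_def mem_coeffs del: of_nat_add of_nat_mult of_nat_Suc)
  have S: "type_of c ?n P m ` {\<alpha> * ?n + \<beta>..q * ?n + s * (int c + int i + t)} =
      type_of c ?n P m ` {\<alpha> * ?n + \<beta>..q * ?n + s * (int c + int j + t)}"
    if "m \<le> c" "\<alpha> \<in> coeffs c" "\<beta> \<in> coeffs c" "\<bar>q\<bar> \<le> int ?K" "s \<in> {-1, 1}" "\<bar>t\<bar> \<le> int c" for m \<alpha> \<beta> q s t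
    using fun_cong[OF arg_cong[OF ij(3), of snd], of "(m, \<alpha>, \<beta>, q, s, t)"] that
    by (simp add: column_def mem_coeffs del: of_nat_add of_nat_mult of_nat_Suc)
  have "agree_types (int ?K) c P"
    using P S unfolding agree_types_def agree_def by simp
  then have "truth (\<lambda>p x. P p (emb x)) f (e(v := n'))"
    using truth_emb[of "int ?K" c P v f e "e(v := n')"] f e(1) by (simp add: algebra_simps)
  then show ?thesis
    using that[of "\<lambda>p x. P p (emb x)" "e(v := n')"] n'_pos n'_def ij(1) by simp
qed

lemma small_parameter:
  assumes "1 \<le> c" "uniform c v f" "depth f \<le> c" "free_vars f \<subseteq> {v}"
    and "truth P f e" "0 \<le> e v"
  obtains P' e' where "truth P' f e'" "0 \<le> e' v" "e' v \<le> int (threshold c)"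
proof -
  have "\<exists>P' e'. truth P' f e' \<and> 0 \<le> e' v \<and> e' v \<le> int (threshold c)"
    using assms(5,6)
  proof (induction "nat (e v)" arbitrary: P e rule: less_induct)
    case less
    show ?case
    proof (cases "e v \<le> int (threshold c)")
      case False
      then obtain P' e' where *: "truth P' f e'" "0 \<le> e' v" "e' v < e v"
        using truth_pump[OF assms(1-4) less.prems(1)] by (metis not_le)
      show ?thesis by (rule less.hyps[OF _ *(1,2)]) (use * in auto)
    qed (use less.prems in blast)
  qed
  then show ?thesis using that by blast
qed

section \<open>Evaluation of schemata\<close>

text \<open>An assignment with values in \<open>{- G..G}\<close> is coded by the digits of a number in base \<open>2 * G + 1\<close>,
  shifted by \<open>G\<close>.\<close>

definition digit :: "nat \<Rightarrow> nat \<Rightarrow> nat \<Rightarrow> nat" where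
  "digit G E v = E div (2 * G + 1) ^ v mod (2 * G + 1)"

definition num_envs :: "nat \<Rightarrow> nat \<Rightarrow> nat" where
  "num_envs c G = (2 * G + 1) ^ Suc c"

definition encodes_env :: "nat \<Rightarrow> nat \<Rightarrow> nat \<Rightarrow> (avar \<Rightarrow> int) \<Rightarrow> bool" where
  "encodes_env c G E e \<longleftrightarrow> E < num_envs c G \<and> (\<forall>u\<le>c. e u = int (digit G E u) - int G)"

lemma ex_digits:
  assumes "\<And>v. v < k \<Longrightarrow> g v \<le> 2 * G"
  shows "\<exists>E<(2 * G + 1) ^ k. \<forall>v<k. digit G E v = g v"
  using assms
proof (induction k arbitrary: g)
  case (Suc k)
  obtain E where E: "E < (2 * G + 1) ^ k" "\<And>v. v < k \<Longrightarrow> digit G E v = g (Suc v)"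
    using Suc.IH[of "\<lambda>v. g (Suc v)"] Suc.prems by force
  have g0: "g 0 < 2 * G + 1" using Suc.prems[of 0] by simp
  define E' where "E' = g 0 + (2 * G + 1) * E"
  have "E' < (2 * G + 1) * (E + 1)" using g0 by (simp add: E'_def)
  also have "\<dots> \<le> (2 * G + 1) ^ Suc k"
    unfolding power_Suc using E(1) by (intro mult_left_mono) auto
  finally have "E' < (2 * G + 1) ^ Suc k" .
  moreover have "digit G E' v = g v" if "v < Suc k" for v
  proof (cases v)
    case 0
    have "E' mod (2 * G + 1) = g 0" using g0 unfolding E'_def by (simp only: mod_mult_self2 mod_less)
    then show ?thesis by (simp add: digit_def 0)
  next
    case (Suc u)
    have "E' div (2 * G + 1) = E" using g0 unfolding E'_def by (subst div_mult_self2) auto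
    then have "digit G E' v = digit G E u"
      unfolding digit_def Suc power_Suc div_mult2_eq by simp
    then show ?thesis using E(2)[of u] that Suc by simp
  qed
  ultimately show ?case by blast
qed simp

lemma digit_le: "digit G E v \<le> 2 * G"
proof -
  have "digit G E v < 2 * G + 1" unfolding digit_def by (rule mod_less_divisor) simp
  then show ?thesis by simp
qed

lemma ex_encodes_env:
  assumes "\<And>u. u \<le> c \<Longrightarrow> \<bar>e u\<bar> \<le> int G"
  shows "\<exists>E. encodes_env c G E e"
proof -
  have "\<exists>E<(2 * G + 1) ^ Suc c. \<forall>v<Suc c. digit G E v = nat (e v + int G)"
    by (rule ex_digits) (use assms in \<open>force simp: less_Suc_eq_le\<close>)
  then obtain E where E: "E < (2 * G + 1) ^ Suc c" "\<And>v. v < Suc c \<Longrightarrow> digit G E v = nat (e v + int G)"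
    by blast
  have "e u = int (digit G E u) - int G" if "u \<le> c" for u
    using E(2)[of u] assms[OF that] that by simp
  then show ?thesis using E(1) unfolding encodes_env_def num_envs_def by blast
qed

text \<open>Integer values are represented as differences of two natural numbers.\<close>

definition aexp_step :: "nat \<Rightarrow> nat \<Rightarrow> nat \<Rightarrow> nat \<Rightarrow> nat" where
  "aexp_step G E m h =
    (if p1 m = 0 then prod_encode (digit G E (p2 m), G)
     else if p1 m = 1 then prod_encode (0, 0)
     else if p1 m = 2 then prod_encode (Suc (p1 (lookup m h (p2 m))), p2 (lookup m h (p2 m)))
     else if p1 m = 3 then
       prod_encode (p1 (lookup m h (p1 (p2 m))) + p1 (lookup m h (p2 (p2 m))),
         p2 (lookup m h (p1 (p2 m))) + p2 (lookup m h (p2 (p2 m))))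
     else
       prod_encode (p1 (lookup m h (p1 (p2 m))) + p2 (lookup m h (p2 (p2 m))),
         p2 (lookup m h (p1 (p2 m))) + p1 (lookup m h (p2 (p2 m)))))"

definition pos_val :: "nat \<Rightarrow> nat \<Rightarrow> nat \<Rightarrow> nat" where
  "pos_val G E x = p1 (cov_rec (aexp_step G E) x)"

definition neg_val :: "nat \<Rightarrow> nat \<Rightarrow> nat \<Rightarrow> nat" where
  "neg_val G E x = p2 (cov_rec (aexp_step G E) x)"

lemma pos_val_diff_neg_val:
  assumes "encodes_env c G E e" "code_aexp a \<le> c"
  shows "int (pos_val G E (code_aexp a)) - int (neg_val G E (code_aexp a)) = aval e a"
  using assms(2)
proof (induction a)
  case (AVar v)
  then have "v \<le> c" using prod_encode_ge[of 0 v] by simp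
  then show ?case using assms(1)
    by (simp add: pos_val_def neg_val_def cov_rec_def[of _ "prod_encode (0, v)"] aexp_step_def encodes_env_def)
next
  case Zero
  show ?case by (simp add: pos_val_def neg_val_def cov_rec_def[of _ "prod_encode (1, 0)"] aexp_step_def del: One_nat_def)
next
  case (Succ a)
  have "code_aexp a < prod_encode (2, code_aexp a)" by (rule code_less_unary) simp
  then show ?case using Succ
    by (simp add: pos_val_def neg_val_def cov_rec_def[of _ "prod_encode (2, code_aexp a)"] aexp_step_def lookup_hist)
next
  case (Plus a b)
  have "code_aexp a < prod_encode (3, prod_encode (code_aexp a, code_aexp b))"
    "code_aexp b < prod_encode (3, prod_encode (code_aexp a, code_aexp b))"
    by (simp_all add: code_less_binary)
  then show ?case using Plus
    by (simp add: pos_val_def neg_val_def cov_rec_def[of _ "prod_encode (3, prod_encode (code_aexp a, code_aexp b))"]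
        aexp_step_def lookup_hist)
next
  case (Minus a b)
  have "code_aexp a < prod_encode (4, prod_encode (code_aexp a, code_aexp b))"
    "code_aexp b < prod_encode (4, prod_encode (code_aexp a, code_aexp b))"
    by (simp_all add: code_less_binary)
  then show ?case using Minus
    by (simp add: pos_val_def neg_val_def cov_rec_def[of _ "prod_encode (4, prod_encode (code_aexp a, code_aexp b))"]
        aexp_step_def lookup_hist)
qed

text \<open>The updated value is \<open>digit G E' i\<close> minus \<open>G\<close>. The two
  comparisons with the bounds are rearranged so that only sums of natural numbers occur.\<close>

definition in_range :: "nat \<Rightarrow> nat \<Rightarrow> nat \<Rightarrow> nat \<Rightarrow> nat \<Rightarrow> nat \<Rightarrow> nat \<Rightarrow> bool" where
  "in_range c G i x y E E' \<longleftrightarrow> (\<forall>u<Suc c. u = i \<or> digit G E' u = digit G E u) \<and>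
     pos_val G E x + G \<le> digit G E' i + neg_val G E x \<and>
     digit G E' i + neg_val G E y \<le> pos_val G E y + G"

text \<open>The tags are those of \<^const>\<open>code_schema\<close>; \<open>V\<close> codes the valuation as a finite set, with indices
  shifted by \<open>G\<close>, and \<open>h\<close> gives the codes of the sets of assignments satisfying the subschemata.\<close>

definition holds :: "nat \<Rightarrow> nat \<Rightarrow> nat \<Rightarrow> nat \<Rightarrow> nat \<Rightarrow> nat \<Rightarrow> bool" where
  "holds c G V m h E \<longleftrightarrow>
     p1 m = 0 \<or>
     p1 m = 2 \<and> pos_val G E (p1 (p2 m)) + neg_val G E (p2 (p2 m)) <
       pos_val G E (p2 (p2 m)) + neg_val G E (p1 (p2 m)) \<or>
     p1 m = 3 \<and>
       prod_encode (p1 (p2 m), pos_val G E (p2 (p2 m)) + G - neg_val G E (p2 (p2 m))) \<in> set_decode V \<or>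
     p1 m = 4 \<and> (E \<in> set_decode (lookup m h (p1 (p2 m))) \<or> E \<in> set_decode (lookup m h (p2 (p2 m)))) \<or>
     p1 m = 5 \<and> (E \<in> set_decode (lookup m h (p1 (p2 m))) \<and> E \<in> set_decode (lookup m h (p2 (p2 m)))) \<or>
     p1 m = 6 \<and> \<not> E \<in> set_decode (lookup m h (p2 m)) \<or>
     p1 m = 7 \<and> (\<forall>E'<num_envs c G.
       in_range c G (p1 (p2 m)) (p1 (p2 (p2 m))) (p1 (p2 (p2 (p2 m)))) E E' \<longrightarrow>
       E' \<in> set_decode (lookup m h (p2 (p2 (p2 (p2 m)))))) \<or>
     p1 m = 8 \<and> (\<exists>E'<num_envs c G.
       in_range c G (p1 (p2 m)) (p1 (p2 (p2 m))) (p1 (p2 (p2 (p2 m)))) E E' \<and>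
       E' \<in> set_decode (lookup m h (p2 (p2 (p2 (p2 m))))))"

text \<open>The recursion on codes stores the whole set of satisfying assignments, as a binary
  number, because an iteration needs its body under other assignments than the current one.\<close>

definition truth_step :: "nat \<Rightarrow> nat \<Rightarrow> nat \<Rightarrow> nat \<Rightarrow> nat \<Rightarrow> nat" where
  "truth_step c G V m h = (\<Sum>E<num_envs c G. if holds c G V m h E then 2 ^ E else 0)"

definition truth_set :: "nat \<Rightarrow> nat \<Rightarrow> nat \<Rightarrow> nat \<Rightarrow> nat" where
  "truth_set c G V = cov_rec (truth_step c G V)"

lemma mem_set_decode_sum:
  "E \<in> set_decode (\<Sum>E<k. if Q E then 2 ^ E else 0) \<longleftrightarrow> E < k \<and> Q E"
proof -
  have "(\<Sum>E<k. if Q E then 2 ^ E else 0) = set_encode {E. E < k \<and> Q E}"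
    by (simp add: set_encode_def sum.If_cases Collect_conj_eq lessThan_def)
  then show ?thesis by (simp add: set_encode_inverse)
qed

lemma mem_truth_set:
  "E \<in> set_decode (truth_set c G V x) \<longleftrightarrow> E < num_envs c G \<and>
     holds c G V x (hist (truth_step c G V) x) E"
  unfolding truth_set_def cov_rec_def truth_step_def[of _ _ _ x] by (rule mem_set_decode_sum)

lemma lookup_truth_set:
  "y < x \<Longrightarrow> lookup x (hist (truth_step c G V) x) y
    = truth_set c G V y"
  unfolding truth_set_def by (rule lookup_hist)

text \<open>An iteration reaches only those updates that a code of an assignment can express. This
  intermediate semantics separates the correctness of the evaluator, valid for every
  \<open>G\<close>, from the choice of a sufficiently large \<open>G\<close>.\<close>

primrec clipped_truth :: "nat \<Rightarrow> (psym \<Rightarrow> int \<Rightarrow> bool) \<Rightarrow> schema \<Rightarrow> (avar \<Rightarrow> int) \<Rightarrow> bool" where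
  "clipped_truth G P Top e \<longleftrightarrow> True"
| "clipped_truth G P Bot e \<longleftrightarrow> False"
| "clipped_truth G P (Less a b) e \<longleftrightarrow> aval e a < aval e b"
| "clipped_truth G P (IProp p a) e \<longleftrightarrow> P p (aval e a)"
| "clipped_truth G P (Or f g) e \<longleftrightarrow> clipped_truth G P f e \<or> clipped_truth G P g e"
| "clipped_truth G P (And f g) e \<longleftrightarrow> clipped_truth G P f e \<and> clipped_truth G P g e"
| "clipped_truth G P (Neg f) e \<longleftrightarrow> \<not> clipped_truth G P f e"
| "clipped_truth G P (BigAnd i a b f) e \<longleftrightarrow>
     (\<forall>k\<in>{aval e a..aval e b} \<inter> {- int G..int G}. clipped_truth G P f (e(i := k)))"
| "clipped_truth G P (BigOr i a b f) e \<longleftrightarrow>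
     (\<exists>k\<in>{aval e a..aval e b} \<inter> {- int G..int G}. clipped_truth G P f (e(i := k)))"

lemma in_range_iff:
  assumes E: "encodes_env c G E e" and ab: "code_aexp a \<le> c" "code_aexp b \<le> c" and i: "i \<le> c"
  shows "E' < num_envs c G \<and> in_range c G i (code_aexp a) (code_aexp b) E E' \<longleftrightarrow>
    (\<exists>k\<in>{aval e a..aval e b} \<inter> {- int G..int G}. encodes_env c G E' (e(i := k)))"
proof
  note a = pos_val_diff_neg_val[OF E ab(1)] and b = pos_val_diff_neg_val[OF E ab(2)]
  {
    assume *: "E' < num_envs c G \<and> in_range c G i (code_aexp a) (code_aexp b) E E'"
    let ?k = "int (digit G E' i) - int G"
    have "encodes_env c G E' (e(i := ?k))"
      using E * unfolding encodes_env_def in_range_def by (simp add: less_Suc_eq_le) metis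
    moreover have "?k \<in> {aval e a..aval e b} \<inter> {- int G..int G}"
      using * digit_le[of G E' i] unfolding a[symmetric] b[symmetric] in_range_def by simp
    ultimately show "\<exists>k\<in>{aval e a..aval e b} \<inter> {- int G..int G}. encodes_env c G E' (e(i := k))" by blast
  }
  {
    assume "\<exists>k\<in>{aval e a..aval e b} \<inter> {- int G..int G}. encodes_env c G E' (e(i := k))"
    then obtain k where k: "aval e a \<le> k" "k \<le> aval e b" and E': "encodes_env c G E' (e(i := k))" by auto
    have "k = int (digit G E' i) - int G" using E' i unfolding encodes_env_def by force
    moreover have "u = i \<or> digit G E' u = digit G E u" if "u < Suc c" for u
    proof -
      have "u = i \<or> int (digit G E' u) - int G = int (digit G E u) - int G"
        using E E' that unfolding encodes_env_def less_Suc_eq_le by (metis fun_upd_other)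
      then show ?thesis by simp
    qed
    ultimately show "E' < num_envs c G \<and> in_range c G i (code_aexp a) (code_aexp b) E E'"
      using a b k E' unfolding in_range_def encodes_env_def by force
  }
qed

lemma ex_encodes_env_update:
  assumes "encodes_env c G E e" "\<bar>k\<bar> \<le> int G"
  shows "\<exists>E'. encodes_env c G E' (e(i := k))"
proof (rule ex_encodes_env)
  fix u assume "u \<le> c"
  then have "e u = int (digit G E u) - int G" using assms(1) by (simp add: encodes_env_def)
  moreover have "int (digit G E u) \<le> 2 * int G" using digit_le[of G E u] by linarith
  ultimately show "\<bar>(e(i := k)) u\<bar> \<le> int G" using assms(2) by auto
qed

lemma truth_set_iff:
  assumes "encodes_env c G E e" "code_schema f \<le> c"
  shows "E \<in> set_decode (truth_set c G V (code_schema f)) \<longleftrightarrow>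
    clipped_truth G (\<lambda>p k. prod_encode (p, nat (k + int G)) \<in> set_decode V) f e"
  using assms
proof (induction f arbitrary: E e)
  case (Less a b)
  have "code_aexp a \<le> c" "code_aexp b \<le> c"
    using Less.prems(2) code_less_binary[of 2, where x = "code_aexp a" and y = "code_aexp b"] by auto
  then show ?case using pos_val_diff_neg_val[OF Less.prems(1), of a]
      pos_val_diff_neg_val[OF Less.prems(1), of b] Less.prems(1)
    by (simp add: mem_truth_set holds_def encodes_env_def) linarith
next
  case (IProp p a)
  have "code_aexp a \<le> c"
    using IProp.prems(2) code_less_binary[of 3, where x = p and y = "code_aexp a"] by auto
  \<comment> \<open>Subtraction of natural numbers and \<open>nat\<close> truncate in the same way,
    so the equation also holds for indices below \<open>- int G\<close>.\<close>
  then have "nat (aval e a + int G) = pos_val G E (code_aexp a) + G - neg_val G E (code_aexp a)"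
    using pos_val_diff_neg_val[OF IProp.prems(1), of a] by simp
  then show ?case using IProp.prems(1)
    by (simp add: mem_truth_set holds_def encodes_env_def)
next
  case (Or f g)
  note lt = code_less_binary[of 4, where x = "code_schema f" and y = "code_schema g", simplified]
  have "code_schema f \<le> c" "code_schema g \<le> c" using Or.prems(2) lt by auto
  note IH = Or.IH(1)[OF Or.prems(1) this(1)] Or.IH(2)[OF Or.prems(1) this(2)]
  show ?case using Or.prems(1)
    by (simp add: mem_truth_set[of _ _ _ _ "prod_encode (4, _)"] holds_def encodes_env_def
        lookup_truth_set[OF lt(1)] lookup_truth_set[OF lt(2)] IH)
next
  case (And f g)
  note lt = code_less_binary[of 5, where x = "code_schema f" and y = "code_schema g", simplified]
  have "code_schema f \<le> c" "code_schema g \<le> c" using And.prems(2) lt by auto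
  note IH = And.IH(1)[OF And.prems(1) this(1)] And.IH(2)[OF And.prems(1) this(2)]
  show ?case using And.prems(1)
    by (simp add: mem_truth_set[of _ _ _ _ "prod_encode (5, _)"] holds_def encodes_env_def
        lookup_truth_set[OF lt(1)] lookup_truth_set[OF lt(2)] IH)
next
  case (Neg f)
  note lt = code_less_unary[of 6 "code_schema f", simplified]
  have "code_schema f \<le> c" using Neg.prems(2) lt by auto
  note IH = Neg.IH[OF Neg.prems(1) this]
  show ?case using Neg.prems(1)
    by (simp add: mem_truth_set[of _ _ _ _ "prod_encode (6, _)"] holds_def encodes_env_def
        lookup_truth_set[OF lt] IH)
next
  case (BigAnd i a b f)
  note lt = code_less_iter[of 7, where x = "code_aexp a" and y = "code_aexp b" and i = i and z = "code_schema f", simplified]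
  have le: "code_aexp a \<le> c" "code_aexp b \<le> c" "i \<le> c" "code_schema f \<le> c"
    using BigAnd.prems(2) lt by auto
  note IH = BigAnd.IH[OF _ le(4)]
  have ex: "\<exists>E'. encodes_env c G E' (e(i := k))" if "k \<in> {aval e a..aval e b} \<inter> {- int G..int G}" for k
    using ex_encodes_env_update[OF BigAnd.prems(1), of k] that by auto
  have "E \<in> set_decode (truth_set c G V (code_schema (BigAnd i a b f))) \<longleftrightarrow>
    (\<forall>E'. E' < num_envs c G \<and> in_range c G i (code_aexp a) (code_aexp b) E E' \<longrightarrow>
      E' \<in> set_decode (truth_set c G V (code_schema f)))"
    using BigAnd.prems(1)
    by (simp add: mem_truth_set[of _ _ _ _ "prod_encode (7, _)"] holds_def encodes_env_def
        lookup_truth_set[OF lt(4)]) blast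
  also have "\<dots> \<longleftrightarrow> clipped_truth G (\<lambda>p k. prod_encode (p, nat (k + int G)) \<in> set_decode V) (BigAnd i a b f) e"
    unfolding in_range_iff[OF BigAnd.prems(1) le(1-3)] clipped_truth.simps using IH ex by blast
  finally show ?case .
next
  case (BigOr i a b f)
  note lt = code_less_iter[of 8, where x = "code_aexp a" and y = "code_aexp b" and i = i and z = "code_schema f", simplified]
  have le: "code_aexp a \<le> c" "code_aexp b \<le> c" "i \<le> c" "code_schema f \<le> c"
    using BigOr.prems(2) lt by auto
  note IH = BigOr.IH[OF _ le(4)]
  have ex: "\<exists>E'. encodes_env c G E' (e(i := k))" if "k \<in> {aval e a..aval e b} \<inter> {- int G..int G}" for k
    using ex_encodes_env_update[OF BigOr.prems(1), of k] that by auto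
  have "E \<in> set_decode (truth_set c G V (code_schema (BigOr i a b f))) \<longleftrightarrow>
    (\<exists>E'. (E' < num_envs c G \<and> in_range c G i (code_aexp a) (code_aexp b) E E') \<and>
      E' \<in> set_decode (truth_set c G V (code_schema f)))"
    using BigOr.prems(1)
    by (simp add: mem_truth_set[of _ _ _ _ "prod_encode (8, _)"] holds_def encodes_env_def
        lookup_truth_set[OF lt(4)])
  also have "\<dots> \<longleftrightarrow> clipped_truth G (\<lambda>p k. prod_encode (p, nat (k + int G)) \<in> set_decode V) (BigOr i a b f) e"
    unfolding in_range_iff[OF BigOr.prems(1) le(1-3)] clipped_truth.simps using IH ex by blast
  finally show ?case .
qed (simp_all add: mem_truth_set holds_def encodes_env_def)

text \<open>\<open>W\<close> bounds the part of a term that does not involve a bound variable. Each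
  iteration raises the bound \<open>M\<close> on the values of the variables by at most
  \<open>W\<close>, and the index of an atom adds \<open>W\<close> once more, whence
  \<open>Suc (depth f)\<close>. As long as the total stays below \<open>G\<close>, clipping removes
  nothing and no index leaves the grid.\<close>

lemma clipped_truth_eq:
  assumes "\<And>p k. p \<le> c \<Longrightarrow> \<bar>k\<bar> \<le> int G \<Longrightarrow> P p k = P' p k"
    and W: "W = int c * int N + int c"
    and "uniform c v f" "\<bar>e v\<bar> \<le> int N" "0 \<le> M"
    and "\<And>u. u \<in> free_vars f - {v} \<Longrightarrow> \<bar>e u\<bar> \<le> M"
    and "M + int (Suc (depth f)) * W \<le> int G"
  shows "clipped_truth G P f e = truth P' f e"
  using assms(3-)
proof (induction f arbitrary: e M)
  have index: "\<bar>aval e a\<bar> \<le> W + M"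
    if a: "index_term c v a" "\<bar>e v\<bar> \<le> int N" "\<And>u. u \<in> avars a - {v} \<Longrightarrow> \<bar>e u\<bar> \<le> M" "0 \<le> M" for a e M
  proof -
    obtain \<alpha> \<gamma> \<epsilon> j where *: "\<bar>\<alpha>\<bar> \<le> int c" "\<bar>\<gamma>\<bar> \<le> int c" "\<epsilon> \<in> {-1, 0, 1}"
      "\<epsilon> = 0 \<or> j \<in> avars a - {v}" "\<forall>e. aval e a = \<alpha> * e v + \<gamma> + \<epsilon> * e j"
      using a(1) unfolding index_term_def by (elim exE conjE)
    have "\<bar>\<alpha> * e v\<bar> \<le> int c * int N" unfolding abs_mult using *(1) that(2) by (intro mult_mono) auto
    moreover have "\<bar>\<epsilon> * e j\<bar> \<le> M" using *(3,4) that(3)[of j] that(4) by auto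
    ultimately show ?thesis using W *(2) *(5)[rule_format, of e] by linarith
  qed
  have param: "\<bar>aval e a\<bar> \<le> W" if a: "param_term c v a" "\<bar>e v\<bar> \<le> int N" for a e
  proof -
    obtain \<alpha> \<gamma> where *: "\<bar>\<alpha>\<bar> \<le> int c" "\<bar>\<gamma>\<bar> \<le> int c" "\<forall>e. aval e a = \<alpha> * e v + \<gamma>"
      using a(1) unfolding param_term_def by (elim exE conjE)
    have "\<bar>\<alpha> * e v\<bar> \<le> int c * int N" unfolding abs_mult using *(1) that(2) by (intro mult_mono) auto
    then show ?thesis using W *(2) *(3)[rule_format, of e] by linarith
  qed
  have W0: "0 \<le> W" by (simp add: W)
  have range: "(\<forall>k\<in>{aval e a..aval e b}. \<bar>k\<bar> \<le> M + W) \<and> {aval e a..aval e b} \<inter> {- int G..int G} = {aval e a..aval e b}"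
    if "param_term c v a" "index_term c v b" "\<bar>e v\<bar> \<le> int N" "0 \<le> M"
      "\<And>u. u \<in> avars b - {v} \<Longrightarrow> \<bar>e u\<bar> \<le> M" "M + int (Suc (Suc k)) * W \<le> int G" for a b e M k
  proof -
    have "0 \<le> int k * W" by (simp add: W)
    moreover have "M + int (Suc (Suc k)) * W = M + W + W + int k * W" by (simp add: algebra_simps)
    ultimately have "M + W + W \<le> int G" using that(6) by linarith
    moreover have "0 \<le> W" by (simp add: W)
    ultimately show ?thesis
      using param[of a e] index[of b e M] that by auto
  qed
  {
    case (IProp p a)
    have "\<bar>aval e a\<bar> \<le> W + M" using IProp by (intro index) auto
    then have "\<bar>aval e a\<bar> \<le> int G" using IProp.prems(5) by simp
    then show ?case using assms(1) IProp.prems(1) by simp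
  next
    case (Or f g)
    have "int (Suc (depth f)) * W \<le> int (Suc (depth (Or f g))) * W"
      "int (Suc (depth g)) * W \<le> int (Suc (depth (Or f g))) * W" by (rule mult_right_mono; simp add: W)+
    then have "clipped_truth G P f e = truth P' f e" "clipped_truth G P g e = truth P' g e"
      using Or.prems by (intro Or.IH[of e M]; force)+
    then show ?case by simp
  next
    case (And f g)
    have "int (Suc (depth f)) * W \<le> int (Suc (depth (And f g))) * W"
      "int (Suc (depth g)) * W \<le> int (Suc (depth (And f g))) * W" by (rule mult_right_mono; simp add: W)+
    then have "clipped_truth G P f e = truth P' f e" "clipped_truth G P g e = truth P' g e"
      using And.prems by (intro And.IH[of e M]; force)+
    then show ?case by simp
  next
    case (Neg f)
    have "clipped_truth G P f e = truth P' f e" using Neg.prems by (intro Neg.IH[of e M]) auto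
    then show ?case by simp
  next
    case (BigAnd i a b f)
    have *: "(\<forall>k\<in>{aval e a..aval e b}. \<bar>k\<bar> \<le> M + W) \<and> {aval e a..aval e b} \<inter> {- int G..int G} = {aval e a..aval e b}"
      using BigAnd.prems by (intro range[where k = "depth f"]) auto
    have "clipped_truth G P f (e(i := k)) = truth P' f (e(i := k))" if "k \<in> {aval e a..aval e b}" for k
    proof (rule BigAnd.IH[where M = "M + W"])
      show "\<bar>(e(i := k)) u\<bar> \<le> M + W" if "u \<in> free_vars f - {v}" for u
        using BigAnd.prems(4)[of u] conjunct1[OF *] that \<open>k \<in> _\<close> W0 by (cases "u = i") auto
    qed (use BigAnd.prems W0 in \<open>auto simp: algebra_simps\<close>)
    then show ?case unfolding clipped_truth.simps truth.simps conjunct2[OF *] by simp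
  next
    case (BigOr i a b f)
    have *: "(\<forall>k\<in>{aval e a..aval e b}. \<bar>k\<bar> \<le> M + W) \<and> {aval e a..aval e b} \<inter> {- int G..int G} = {aval e a..aval e b}"
      using BigOr.prems by (intro range[where k = "depth f"]) auto
    have "clipped_truth G P f (e(i := k)) = truth P' f (e(i := k))" if "k \<in> {aval e a..aval e b}" for k
    proof (rule BigOr.IH[where M = "M + W"])
      show "\<bar>(e(i := k)) u\<bar> \<le> M + W" if "u \<in> free_vars f - {v}" for u
        using BigOr.prems(4)[of u] conjunct1[OF *] that \<open>k \<in> _\<close> W0 by (cases "u = i") auto
    qed (use BigOr.prems W0 in \<open>auto simp: algebra_simps\<close>)
    then show ?case unfolding clipped_truth.simps truth.simps conjunct2[OF *] by simp
  }
qed auto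

section \<open>The decision procedure\<close>

lemma computable_num_types:
  assumes "computable k a" "computable k b"
  shows "computable k (\<lambda>xs. num_types (a xs) (b xs))"
proof (rule computable_comp2[OF _ assms])
  have "num_types c m = rec_nat (2 ^ ((c + 1) * ((2 * c + 1) * ((2 * c + 1) * 3)))) (\<lambda>_ r. r *
     (2 ^ r) ^ ((2 * c + 1) * ((2 * c + 1) * ((2 * c + 1) * ((2 * c + 1) * 3))))) m" for c m
    by (induction m) auto
  then show "computable 2 (\<lambda>xs. num_types (arg 0 xs) (arg 1 xs))"
    by (simp only:) (intro computable_rec_nat computable_intros; simp)
qed

lemma computable_threshold:
  assumes "computable k a"
  shows "computable k (\<lambda>xs. threshold (a xs))"
  using assms unfolding threshold_def num_columns_def
  by (intro computable_intros computable_num_types)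

lemma computable_digit:
  assumes "computable k a" "computable k b" "computable k c"
  shows "computable k (\<lambda>xs. digit (a xs) (b xs) (c xs))"
  using assms unfolding digit_def by (intro computable_intros computable_div computable_mod)

lemma computable_num_envs:
  assumes "computable k a" "computable k b"
  shows "computable k (\<lambda>xs. num_envs (a xs) (b xs))"
  using assms unfolding num_envs_def by (intro computable_intros)

lemma computable_aexp_rec:
  assumes "computable k a" "computable k b" "computable k c"
  shows "computable k (\<lambda>xs. cov_rec (aexp_step (a xs) (b xs)) (c xs))"
proof (rule computable_comp3[OF _ assms])
  show "computable 3 (\<lambda>xs. cov_rec (aexp_step (arg 0 xs) (arg 1 xs)) (arg 2 xs))"
    unfolding aexp_step_def[abs_def]
    by (intro computable_cov_rec computable_intros computable_prod_encode computable_p1 computable_p2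
        computable_lookup computable_digit; simp)
qed

lemma computable_pos_val:
  assumes "computable k a" "computable k b" "computable k c"
  shows "computable k (\<lambda>xs. pos_val (a xs) (b xs) (c xs))"
  using assms unfolding pos_val_def by (intro computable_p1 computable_aexp_rec)

lemma computable_neg_val:
  assumes "computable k a" "computable k b" "computable k c"
  shows "computable k (\<lambda>xs. neg_val (a xs) (b xs) (c xs))"
  using assms unfolding neg_val_def by (intro computable_p2 computable_aexp_rec)

lemma computable_truth_set:
  assumes "computable k a" "computable k b" "computable k c" "computable k d"
  shows "computable k (\<lambda>xs. truth_set (a xs) (b xs) (c xs) (d xs))"
proof (rule computable_comp4[OF _ assms])
  show "computable 4 (\<lambda>xs. truth_set (arg 0 xs) (arg 1 xs) (arg 2 xs) (arg 3 xs))"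
    unfolding truth_set_def truth_step_def[abs_def] holds_def in_range_def
    by (intro computable_cov_rec computable_intros computable_prod_encode computable_p1 computable_p2
        computable_lookup computable_digit computable_pos_val computable_neg_val computable_num_envs
        decidable_mem_set_decode; simp)
qed

text \<open>The requirement of \<open>clipped_truth_eq\<close> for M = 0 and a parameter up to
  \<open>threshold c\<close>, with the depth estimated by \<open>c\<close>.\<close>

definition grid :: "nat \<Rightarrow> nat" where
  "grid c = (c + 1) * (c * threshold c + c)"

text \<open>\<open>Suc x\<close> plays the role of \<open>c\<close>. Instead of locating the
  parameter, the test confines every variable up to \<open>Suc x\<close> to the values from 0 to the
  threshold. The range of \<open>V\<close> suffices for all sets of pairs of a symbol up to
  \<open>c\<close> and a shifted index up to twice the grid size.\<close>

definition sat_test :: "nat \<Rightarrow> bool" where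
  "sat_test x \<longleftrightarrow> (\<exists>V<2 ^ Suc (prod_encode (Suc x, 2 * grid (Suc x))). \<exists>E<num_envs (Suc x) (grid (Suc x)).
     (\<forall>u<Suc (Suc x). grid (Suc x) \<le> digit (grid (Suc x)) E u \<and>
        digit (grid (Suc x)) E u \<le> grid (Suc x) + threshold (Suc x)) \<and>
     E \<in> set_decode (truth_set (Suc x) (grid (Suc x)) V x))"

lemma decidable_sat_test: "decidable 1 (\<lambda>xs. sat_test (arg 0 xs))"
  unfolding sat_test_def grid_def
  by (intro computable_intros computable_prod_encode computable_digit computable_num_envs
        computable_truth_set computable_threshold decidable_mem_set_decode; simp)

lemma set_encode_less:
  assumes "A \<subseteq> {..<k}"
  shows "set_encode A < 2 ^ k"
proof -
  have "set_encode A \<le> set_encode {..<k}"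
    unfolding set_encode_def using assms by (intro sum_mono2) auto
  also have "\<dots> < 2 ^ k" by (induction k) (simp_all add: set_encode_def lessThan_Suc)
  finally show ?thesis .
qed

lemma prod_encode_mono:
  assumes "a \<le> a'" "b \<le> b'"
  shows "prod_encode (a, b) \<le> prod_encode (a', b')"
proof -
  have "triangle (a + b) \<le> triangle (a' + b')"
    unfolding triangle_def using assms by (intro div_le_mono mult_le_mono) auto
  then show ?thesis using assms by (simp add: prod_encode_def)
qed

lemma ex_valuation_code:
  "\<exists>V<2 ^ Suc (prod_encode (c, 2 * G)). \<forall>p k. p \<le> c \<longrightarrow> \<bar>k\<bar> \<le> int G \<longrightarrow>
     prod_encode (p, nat (k + int G)) \<in> set_decode V \<longleftrightarrow> P p k"
proof -
  define A where "A = {prod_encode (p, nat (k + int G)) | p k. p \<le> c \<and> \<bar>k\<bar> \<le> int G \<and> P p k}"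
  have A: "A \<subseteq> {..<Suc (prod_encode (c, 2 * G))}"
    unfolding A_def by (auto simp: less_Suc_eq_le intro!: prod_encode_mono)
  have "prod_encode (p, nat (k + int G)) \<in> set_decode (set_encode A) \<longleftrightarrow> P p k"
    if "p \<le> c" "\<bar>k\<bar> \<le> int G" for p k
  proof -
    have "nat (k + int G) = nat (k' + int G) \<longleftrightarrow> k = k'" if "\<bar>k'\<bar> \<le> int G" for k'
      using that \<open>\<bar>k\<bar> \<le> int G\<close> by auto
    then show ?thesis
      using that finite_subset[OF A] unfolding A_def by (auto simp: set_encode_inverse prod_encode_eq)
  qed
  then show ?thesis using set_encode_less[OF A] by blast
qed

lemma sat_test_iff:
  assumes "bound_linear f"
  shows "sat_test (code_schema f) \<longleftrightarrow> satisfiable f"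
proof -
  define c where "c = Suc (code_schema f)"
  let ?G = "grid c" and ?N = "threshold c"
  obtain v where v: "free_vars f \<subseteq> {v}" "uniform c v f"
    using bound_linear_uniform[OF assms] unfolding c_def by blast
  have depth: "depth f \<le> c" "Suc (depth f) \<le> c" using depth_le_code[of f] by (simp_all add: c_def)
  have "Suc (depth f) * (c * ?N + c) \<le> ?G"
    unfolding grid_def using depth by (intro mult_right_mono) auto
  then have G: "0 + int (Suc (depth f)) * int (c * ?N + c) \<le> int ?G"
    unfolding of_nat_mult[symmetric] by linarith
  have "?N \<le> c * ?N + c" "c * ?N + c \<le> ?G" unfolding grid_def by (simp_all add: c_def)
  then have N: "?N \<le> ?G" by linarith
  have clip: "clipped_truth ?G P f e = truth P' f e"
    if "\<And>p k. p \<le> c \<Longrightarrow> \<bar>k\<bar> \<le> int ?G \<Longrightarrow> P p k = P' p k" "\<bar>e v\<bar> \<le> int ?N" for P P' e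
    using that v G by (intro clipped_truth_eq[where c = c and v = v and N = ?N and M = 0]) auto
  have code: "code_schema f \<le> c" by (simp add: c_def)
  show ?thesis
  proof
    assume "sat_test (code_schema f)"
    then obtain V E where E: "E < num_envs c ?G" and
      range: "\<And>u. u \<le> c \<Longrightarrow> ?G \<le> digit ?G E u \<and> digit ?G E u \<le> ?G + ?N" and
      mem: "E \<in> set_decode (truth_set c ?G V (code_schema f))"
      unfolding sat_test_def c_def[symmetric] less_Suc_eq_le by blast
    \<comment> \<open>Variables above \<open>c\<close> have no digit. The default 0 meets the bounds
      even if \<open>v\<close> is among them, which can happen when the schema has no
      parameter.\<close>
    define e where "e = (\<lambda>u. if u \<le> c then int (digit ?G E u) - int ?G else 0)"
    let ?P = "\<lambda>p k. prod_encode (p, nat (k + int ?G)) \<in> set_decode V"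
    have "encodes_env c ?G E e" using E by (simp add: encodes_env_def e_def)
    then have "clipped_truth ?G ?P f e" using truth_set_iff[OF _ code] mem by blast
    moreover have e: "0 \<le> e u \<and> e u \<le> int ?N" for u
      using range[of u] by (auto simp: e_def)
    ultimately have "truth ?P f e" using clip[of ?P ?P e] e[of v] by simp
    then show "satisfiable f" unfolding satisfiable_def using e by blast
  next
    assume "satisfiable f"
    then obtain e P where e: "\<And>u. u \<in> free_vars f \<Longrightarrow> 0 \<le> e u" "truth P f e"
      unfolding satisfiable_def by blast
    \<comment> \<open>If \<open>v\<close> is not free, then satisfiability says nothing about its
      value, which may be negative; resetting it does not affect truth.\<close>
    define e1 where "e1 = e(v := if v \<in> free_vars f then e v else 0)"
    have "truth P f e = truth P f e1" by (rule truth_cong) (use v(1) in \<open>auto simp: e1_def\<close>)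
    then have "truth P f e1" using e(2) by simp
    moreover have "0 \<le> e1 v" using e(1) by (simp add: e1_def)
    ultimately obtain P' e' where e': "truth P' f e'" "0 \<le> e' v" "e' v \<le> int ?N"
      using small_parameter[OF _ v(2) depth(1) v(1), of P e1] by (auto simp: c_def)
    \<comment> \<open>The values of all other variables are arbitrary so far; setting them to 0
      brings the assignment into the grid, where it has a code.\<close>
    define e2 where "e2 = (\<lambda>u. if u = v then e' v else 0)"
    have "truth P' f e' = truth P' f e2" by (rule truth_cong) (use v(1) in \<open>auto simp: e2_def\<close>)
    then have t: "truth P' f e2" using e'(1) by simp
    obtain V where V: "V < 2 ^ Suc (prod_encode (c, 2 * ?G))"
      "\<And>p k. p \<le> c \<Longrightarrow> \<bar>k\<bar> \<le> int ?G \<Longrightarrow>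
         (prod_encode (p, nat (k + int ?G)) \<in> set_decode V) = P' p k"
      using ex_valuation_code[of c ?G P'] by blast
    have "\<bar>e2 u\<bar> \<le> int ?G" for u using e'(2,3) N by (auto simp: e2_def)
    then obtain E where E: "encodes_env c ?G E e2" using ex_encodes_env[of c e2 ?G] by blast
    have "clipped_truth ?G (\<lambda>p k. prod_encode (p, nat (k + int ?G)) \<in> set_decode V) f e2"
      using clip[of _ P' e2] V(2) t e'(2,3) by (simp add: e2_def)
    then have "E \<in> set_decode (truth_set c ?G V (code_schema f))"
      using truth_set_iff[OF E code] by blast
    moreover have "?G \<le> digit ?G E u \<and> digit ?G E u \<le> ?G + ?N" if "u \<le> c" for u
    proof -
      have "int (digit ?G E u) = e2 u + int ?G" using E that by (simp add: encodes_env_def)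
      moreover have "0 \<le> e2 u" "e2 u \<le> int ?N" using e'(2,3) by (simp_all add: e2_def)
      ultimately show ?thesis by linarith
    qed
    ultimately show "sat_test (code_schema f)"
      unfolding sat_test_def c_def[symmetric] less_Suc_eq_le
      using V(1) E unfolding encodes_env_def by blast
  qed
qed

theorem theorem5p23: "decidable_on {\<phi>. bound_linear \<phi>} satisfiable"
proof -
  obtain d where d: "recursive_fn 1 d"
    "\<And>xs. length xs = 1 \<Longrightarrow> d xs = (if sat_test (arg 0 xs) then 1 else 0)"
    using decidable_sat_test unfolding decidable_def computable_def by blast
  have "d [code_schema f] = (if satisfiable f then 1 else 0)" if "bound_linear f" for f
    using d(2)[of "[code_schema f]"] sat_test_iff[OF that] by simp
  then show ?thesis unfolding decidable_on_def using d(1) by blast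
qed

end
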